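(* Let $\sigma$ be an automorphism of $\mathbb{F}_{q^n}$ with fixed field $\mathbb{F}_q$, and let $R=\mathbb{F}_{q^n}[t;\sigma]$. If $f\in R$ is irreducible of degree $d$, then for the centre and the left, middle and right nuclei of the semifield $\mathbb{S}_f$ we have $$(\#Z(\mathbb{S}_f),\#\mathbb{N}_l(\mathbb{S}_f),\#\mathbb{N}_m(\mathbb{S}_f),\#\mathbb{N}_r(\mathbb{S}_f))=(q,q^n,q^n,q^d).$$
   Context: $R=\mathbb{F}_{q^n}[t;\sigma]$ is the skew polynomial ring: polynomials in $t$ with (left) coefficients in $\mathbb{F}_{q^n}$, termwise addition, and multiplication determined by $ta=a^{\sigma}t$ for $a\in\mathbb{F}_{q^n}$. An element $f\in R$ is irreducible if there are no $a,b\in R$ with $\deg(a),\deg(b)<\deg(f)$ and $f=ab$. For $f\neq0$ every $a\in R$ can be written uniquely as $a=uf+v$ with $\deg(v)<\deg(f)$; write $v=a\bmod f$. For $f$ irreducible of degree $d$, $\mathbb{S}_f=(V,\circ_f)$ is the semifield on the set $V$ of elements of $R$ of degree less than $d$ with $a\circ_f b:=ab\bmod f$. For a semifield $(\mathbb{S},\circ)$: $\mathbb{N}_l(\mathbb{S})$, $\mathbb{N}_m(\mathbb{S})$, $\mathbb{N}_r(\mathbb{S})$ are the sets of $x$, respectively $y$, respectively $z$ in $\mathbb{S}$ such that $x\circ(y\circ z)=(x\circ y)\circ z$ for all values in $\mathbb{S}$ of the other two variables. The centre $Z(\mathbb{S})$ is the set of elements of $\mathbb{N}_l\cap\mathbb{N}_m\cap\mathbb{N}_r$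 that commute with all elements of $\mathbb{S}$.
   Formalization: The claim is proved for n, d ≥ 2 or n = d = 1; it fails otherwise: for d = 1, n ≥ 2 the semifield is the field of order q^n, for n = 1, d ≥ 2 the field of order q^d (so the centre is not of order q), and for d = 0 it is {0}. *)

theory Defs
  imports
    "HOL-Computational_Algebra.Polynomial"
    "HOL-Library.Cardinality"
    "HOL-Algebra.Ring"
begin

section \<open>Skew polynomial rings\<close>

definition field_automorphism :: "('a::field \<Rightarrow> 'a) \<Rightarrow> bool" where
  "field_automorphism \<sigma> \<longleftrightarrow>
     bij \<sigma> \<and> (\<forall>x y. \<sigma> (x + y) = \<sigma> x + \<sigma> y) \<and> (\<forall>x y. \<sigma> (x * y) = \<sigma> x * \<sigma> y)"

text \<open>
  Elements of the skew polynomial ring in \<open>t\<close> with left coefficients are represented by the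
  library type of polynomials (for the additive structure and the degree only), with the
  product that extends \<open>(a t\<^sup>i) (b t\<^sup>j) = a \<sigma>\<^sup>i(b) t\<^sup>i\<^sup>+\<^sup>j\<close> biadditively.
\<close>

definition skew_mult :: "('a::field \<Rightarrow> 'a) \<Rightarrow> 'a poly \<Rightarrow> 'a poly \<Rightarrow> 'a poly" where
  "skew_mult \<sigma> a b =
     (\<Sum>i\<le>degree a. \<Sum>j\<le>degree b. monom (coeff a i * (\<sigma> ^^ i) (coeff b j)) (i + j))"

definition skew_poly_ring :: "('a::field \<Rightarrow> 'a) \<Rightarrow> 'a poly ring" where
  "skew_poly_ring \<sigma> =
     \<lparr>carrier = UNIV, monoid.mult = skew_mult \<sigma>, one = 1, ring.zero = 0, add = (+)\<rparr>"

text \<open>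
  Comparison of degrees with the convention that the degree of \<open>0\<close> is \<open>-\<infinity>\<close>; the library
  has \<open>degree 0 = 0\<close>.
\<close>

definition deg_less :: "'a::zero poly \<Rightarrow> 'a poly \<Rightarrow> bool" where
  "deg_less a b \<longleftrightarrow> b \<noteq> 0 \<and> (a = 0 \<or> degree a < degree b)"

definition skew_irreducible :: "('a::field \<Rightarrow> 'a) \<Rightarrow> 'a poly \<Rightarrow> bool" where
  "skew_irreducible \<sigma> f \<longleftrightarrow>
     \<not> (\<exists>a b. deg_less a f \<and> deg_less b f \<and> f = skew_mult \<sigma> a b)"

definition skew_mod :: "('a::field \<Rightarrow> 'a) \<Rightarrow> 'a poly \<Rightarrow> 'a poly \<Rightarrow> 'a poly" where
  "skew_mod \<sigma> a f = (THE v. deg_less v f \<and> (\<exists>u. a = skew_mult \<sigma> u f + v))"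


section \<open>The semifield and its nuclei\<close>

definition skew_semifield :: "('a::field \<Rightarrow> 'a) \<Rightarrow> 'a poly \<Rightarrow> 'a poly ring" where
  "skew_semifield \<sigma> f =
     \<lparr>carrier = {a. deg_less a f},
      monoid.mult = (\<lambda>a b. skew_mod \<sigma> (skew_mult \<sigma> a b) f),
      one = 1, ring.zero = 0, add = (+)\<rparr>"

definition left_nucleus :: "('a, 'm) monoid_scheme \<Rightarrow> 'a set" where
  "left_nucleus S = {x \<in> carrier S. \<forall>y \<in> carrier S. \<forall>z \<in> carrier S.
     x \<otimes>\<^bsub>S\<^esub> (y \<otimes>\<^bsub>S\<^esub> z) = (x \<otimes>\<^bsub>S\<^esub> y) \<otimes>\<^bsub>S\<^esub> z}"

definition middle_nucleus :: "('a, 'm) monoid_scheme \<Rightarrow> 'a set" where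
  "middle_nucleus S = {y \<in> carrier S. \<forall>x \<in> carrier S. \<forall>z \<in> carrier S.
     x \<otimes>\<^bsub>S\<^esub> (y \<otimes>\<^bsub>S\<^esub> z) = (x \<otimes>\<^bsub>S\<^esub> y) \<otimes>\<^bsub>S\<^esub> z}"

definition right_nucleus :: "('a, 'm) monoid_scheme \<Rightarrow> 'a set" where
  "right_nucleus S = {z \<in> carrier S. \<forall>x \<in> carrier S. \<forall>y \<in> carrier S.
     x \<otimes>\<^bsub>S\<^esub> (y \<otimes>\<^bsub>S\<^esub> z) = (x \<otimes>\<^bsub>S\<^esub> y) \<otimes>\<^bsub>S\<^esub> z}"

definition semifield_centre :: "('a, 'm) monoid_scheme \<Rightarrow> 'a set" where
  "semifield_centre S = {x \<in> left_nucleus S \<inter> middle_nucleus S \<inter> right_nucleus S.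
     \<forall>y \<in> carrier S. x \<otimes>\<^bsub>S\<^esub> y = y \<otimes>\<^bsub>S\<^esub> x}"


section \<open>Basic facts\<close>

context
  fixes \<sigma> :: "'a::field \<Rightarrow> 'a"
  assumes aut: "field_automorphism \<sigma>"
begin

lemma funpow_aut:
  "(\<sigma> ^^ i) (x + y) = (\<sigma> ^^ i) x + (\<sigma> ^^ i) y"
  "(\<sigma> ^^ i) (x * y) = (\<sigma> ^^ i) x * (\<sigma> ^^ i) y"
  using aut by (induction i) (auto simp: field_automorphism_def)

lemma funpow_aut_0 [simp]: "(\<sigma> ^^ i) 0 = 0"
  using funpow_aut(1)[of i 0 0] by (metis add.right_neutral add_left_cancel)

lemma funpow_aut_eq_0_iff [simp]: "(\<sigma> ^^ i) x = 0 \<longleftrightarrow> x = 0"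
proof -
  have "inj (\<sigma> ^^ i)"
    using aut by (simp add: field_automorphism_def bij_is_inj inj_fn)
  then show ?thesis by (metis funpow_aut_0 injD)
qed

lemma funpow_aut_1 [simp]: "(\<sigma> ^^ i) 1 = 1"
  using funpow_aut(2)[of i 1 1] funpow_aut_eq_0_iff[of i 1] by simp

lemma skew_mult_bounds:
  assumes "degree a \<le> m" "degree b \<le> k"
  shows "skew_mult \<sigma> a b =
    (\<Sum>i\<le>m. \<Sum>j\<le>k. monom (coeff a i * (\<sigma> ^^ i) (coeff b j)) (i + j))"
proof -
  have "(\<Sum>j\<le>degree b. monom (coeff a i * (\<sigma> ^^ i) (coeff b j)) (i + j)) =
      (\<Sum>j\<le>k. monom (coeff a i * (\<sigma> ^^ i) (coeff b j)) (i + j))" for i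
    using assms(2) by (intro sum.mono_neutral_left) (auto simp: coeff_eq_0)
  moreover have "(\<Sum>i\<le>degree a. \<Sum>j\<le>k. monom (coeff a i * (\<sigma> ^^ i) (coeff b j)) (i + j)) =
      (\<Sum>i\<le>m. \<Sum>j\<le>k. monom (coeff a i * (\<sigma> ^^ i) (coeff b j)) (i + j))"
    using assms(1) by (intro sum.mono_neutral_left) (auto simp: coeff_eq_0)
  ultimately show ?thesis by (simp add: skew_mult_def)
qed

lemma skew_mult_add_left: "skew_mult \<sigma> (a + b) c = skew_mult \<sigma> a c + skew_mult \<sigma> b c"
proof -
  define m where "m = max (degree a) (degree b)"
  have "degree (a + b) \<le> m" "degree a \<le> m" "degree b \<le> m"
    by (auto simp: m_def degree_add_le_max)
  then show ?thesis
    by (simp add: skew_mult_bounds[of _ m _ "degree c"] sum.distrib ring_distribs flip: add_monom)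
qed

lemma skew_mult_add_right: "skew_mult \<sigma> a (b + c) = skew_mult \<sigma> a b + skew_mult \<sigma> a c"
proof -
  define m where "m = max (degree b) (degree c)"
  have "degree (b + c) \<le> m" "degree b \<le> m" "degree c \<le> m"
    by (auto simp: m_def degree_add_le_max)
  then show ?thesis
    by (simp add: skew_mult_bounds[of _ "degree a" _ m] sum.distrib ring_distribs funpow_aut
          flip: add_monom)
qed

lemma skew_mult_0 [simp]: "skew_mult \<sigma> 0 a = 0" "skew_mult \<sigma> a 0 = 0"
  by (simp_all add: skew_mult_def)

lemma skew_mult_monom_monom:
  "skew_mult \<sigma> (monom a i) (monom b j) = monom (a * (\<sigma> ^^ i) b) (i + j)"
proof -
  have *: "monom (coeff (monom a i) i' * (\<sigma> ^^ i') (coeff (monom b j) j')) (i' + j') =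
      (if j' = j then if i' = i then monom (a * (\<sigma> ^^ i) b) (i + j) else 0 else 0)" for i' j'
    by auto
  have "skew_mult \<sigma> (monom a i) (monom b j) =
      (\<Sum>i'\<le>i. \<Sum>j'\<le>j. if j' = j then if i' = i then monom (a * (\<sigma> ^^ i) b) (i + j) else 0 else 0)"
    unfolding * [symmetric] by (intro skew_mult_bounds degree_monom_le)
  then show ?thesis by simp
qed

lemma t_skew_mult_const: "skew_mult \<sigma> (monom 1 1) [:a:] = skew_mult \<sigma> [:\<sigma> a:] (monom 1 1)"
  using skew_mult_monom_monom[of 1 1 a 0] skew_mult_monom_monom[of "\<sigma> a" 0 1 1]
  by (simp add: monom_0)

lemma skew_mult_sum_left: "skew_mult \<sigma> (sum g A) b = (\<Sum>i\<in>A. skew_mult \<sigma> (g i) b)"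
  by (induction A rule: infinite_finite_induct) (auto simp: skew_mult_add_left)

lemma skew_mult_sum_right: "skew_mult \<sigma> a (sum g A) = (\<Sum>i\<in>A. skew_mult \<sigma> a (g i))"
  by (induction A rule: infinite_finite_induct) (auto simp: skew_mult_add_right)

lemma skew_mult_assoc: "skew_mult \<sigma> (skew_mult \<sigma> a b) c = skew_mult \<sigma> a (skew_mult \<sigma> b c)"
proof -
  have monoms: "skew_mult \<sigma> (skew_mult \<sigma> (monom x i) (monom y j)) (monom z k) =
      skew_mult \<sigma> (monom x i) (skew_mult \<sigma> (monom y j) (monom z k))" for x y z i j k
    by (simp add: skew_mult_monom_monom funpow_aut mult.assoc add.assoc funpow_add)
  have "skew_mult \<sigma>
      (skew_mult \<sigma> (\<Sum>i\<le>degree a. monom (coeff a i) i) (\<Sum>j\<le>degree b. monom (coeff b j) j))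
      (\<Sum>k\<le>degree c. monom (coeff c k) k) =
    skew_mult \<sigma> (\<Sum>i\<le>degree a. monom (coeff a i) i)
      (skew_mult \<sigma> (\<Sum>j\<le>degree b. monom (coeff b j) j) (\<Sum>k\<le>degree c. monom (coeff c k) k))"
    by (simp add: skew_mult_sum_left skew_mult_sum_right monoms)
  then show ?thesis by (simp add: poly_as_sum_of_monoms)
qed

lemma skew_mult_1 [simp]: "skew_mult \<sigma> 1 a = a" "skew_mult \<sigma> a 1 = a"
  by (simp_all add: skew_mult_def poly_as_sum_of_monoms)

lemma ring_skew_poly_ring: "ring (skew_poly_ring \<sigma>)"
proof (rule ringI)
  show "abelian_group (skew_poly_ring \<sigma>)"
  proof (rule abelian_groupI)
    fix x assume "x \<in> carrier (skew_poly_ring \<sigma>)"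
    show "\<exists>y \<in> carrier (skew_poly_ring \<sigma>).
        y \<oplus>\<^bsub>skew_poly_ring \<sigma>\<^esub> x = \<zero>\<^bsub>skew_poly_ring \<sigma>\<^esub>"
      by (intro bexI[of _ "- x"]) (simp_all add: skew_poly_ring_def)
  qed (simp_all add: skew_poly_ring_def algebra_simps)
  show "Group.monoid (skew_poly_ring \<sigma>)"
    by (rule monoidI) (simp_all add: skew_poly_ring_def skew_mult_assoc)
qed (simp_all add: skew_poly_ring_def skew_mult_add_left skew_mult_add_right)

lemma coeff_skew_mult_degree_sum:
  "coeff (skew_mult \<sigma> a b) (degree a + degree b) =
     lead_coeff a * (\<sigma> ^^ degree a) (lead_coeff b)"
proof -
  have *: "coeff (monom (coeff a i * (\<sigma> ^^ i) (coeff b j)) (i + j)) (degree a + degree b) =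
      (if j = degree b then
         if i = degree a then lead_coeff a * (\<sigma> ^^ degree a) (lead_coeff b) else 0 else 0)"
    if "i \<le> degree a" "j \<le> degree b" for i j
    using that by auto
  show ?thesis
    by (simp add: skew_mult_def coeff_sum * del: coeff_monom)
qed

lemma degree_skew_mult_le: "degree (skew_mult \<sigma> a b) \<le> degree a + degree b"
  unfolding skew_mult_def
  by (intro degree_sum_le finite_atMost order.trans[OF degree_monom_le]) auto

lemma degree_skew_mult:
  assumes "a \<noteq> 0" "b \<noteq> 0"
  shows "degree (skew_mult \<sigma> a b) = degree a + degree b" "skew_mult \<sigma> a b \<noteq> 0"
proof -
  have "coeff (skew_mult \<sigma> a b) (degree a + degree b) \<noteq> 0"
    using assms by (simp add: coeff_skew_mult_degree_sum)
  then show "degree (skew_mult \<sigma> a b) = degree a + degree b" "skew_mult \<sigma> a b \<noteq> 0"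
    using degree_skew_mult_le by (auto intro: antisym le_degree)
qed

lemma skew_division_exists:
  assumes "f \<noteq> 0"
  shows "\<exists>u v. a = skew_mult \<sigma> u f + v \<and> deg_less v f"
proof (induction "degree a" arbitrary: a rule: less_induct)
  case less
  show ?case
  proof (cases "deg_less a f")
    case True
    then show ?thesis by (intro exI[of _ 0] exI[of _ a]) simp
  next
    case False
    then have a: "a \<noteq> 0" "degree f \<le> degree a" using assms by (auto simp: deg_less_def)
    define k where "k = degree a - degree f"
    define w where "w = monom (lead_coeff a / (\<sigma> ^^ k) (lead_coeff f)) k"
    have w: "w \<noteq> 0" "degree w = k" "lead_coeff w = lead_coeff a / (\<sigma> ^^ k) (lead_coeff f)"
      using a assms by (simp_all add: w_def degree_monom_eq)
    have deg: "degree (skew_mult \<sigma> w f) = degree a"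
      using degree_skew_mult(1)[OF w(1) assms] w(2) a by (simp add: k_def)
    have lead: "coeff (skew_mult \<sigma> w f) (degree a) = lead_coeff a"
      using coeff_skew_mult_degree_sum[of w f] w a assms by (simp add: k_def)
    define r where "r = a - skew_mult \<sigma> w f"
    have "\<exists>u v. r = skew_mult \<sigma> u f + v \<and> deg_less v f"
    proof (cases "degree r < degree a")
      case True
      then show ?thesis by (rule less)
    next
      case False
      moreover have "degree r \<le> degree a"
        unfolding r_def by (rule degree_diff_le) (simp_all add: deg)
      moreover have "coeff r (degree a) = 0" by (simp add: r_def lead)
      ultimately have "r = 0" by (metis leading_coeff_0_iff linorder_neqE_nat not_less)
      then show ?thesis using assms by (intro exI[of _ 0]) (simp add: deg_less_def)
    qed
    then obtain u v where "r = skew_mult \<sigma> u f + v" "deg_less v f" by blast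
    then have "a = skew_mult \<sigma> (w + u) f + v" "deg_less v f"
      by (simp_all add: r_def skew_mult_add_left algebra_simps)
    then show ?thesis by blast
  qed
qed

lemma skew_division_unique:
  assumes eq: "skew_mult \<sigma> u f + v = skew_mult \<sigma> u' f + v'"
    and v: "deg_less v f" "deg_less v' f"
  shows "u = u'" "v = v'"
proof -
  have f: "f \<noteq> 0" using v by (simp add: deg_less_def)
  have "skew_mult \<sigma> u' f + skew_mult \<sigma> (u - u') f = skew_mult \<sigma> u f"
    by (simp flip: skew_mult_add_left)
  with eq have "skew_mult \<sigma> u' f + (skew_mult \<sigma> (u - u') f + v) = skew_mult \<sigma> u' f + v'"
    by (metis add.assoc)
  then have diff: "skew_mult \<sigma> (u - u') f = v' - v"
    by (simp add: eq_diff_eq)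
  show "u = u'"
  proof (rule ccontr)
    assume "u \<noteq> u'"
    then have "degree f \<le> degree (v' - v)" "v' - v \<noteq> 0"
      using degree_skew_mult[of "u - u'" f] f by (simp_all add: diff)
    moreover have "v' - v = 0 \<or> degree (v' - v) < degree f"
      using v by (auto simp: deg_less_def intro: degree_diff_less)
    ultimately show False by auto
  qed
  then show "v = v'" using eq by simp
qed

lemma skew_mod_eqI:
  assumes "a = skew_mult \<sigma> u f + v" "deg_less v f"
  shows "skew_mod \<sigma> a f = v"
  unfolding skew_mod_def
  using assms skew_division_unique(2) by (intro the_equality) blast+

end

end

theory Submission
  imports
    Defs
    "HOL-Computational_Algebra.Fundamental_Theorem_Algebra"
    "HOL-Algebra.Group_Action"
    "HOL-Library.FuncSet"
begin

text \<open>
  Write \<open>K\<close> for the field of size \<open>q\<^sup>n\<close>, \<open>F\<close> for its fixed field, \<open>V\<close> for the residues modulo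
  \<open>R f\<close>, that is, the skew polynomials of degree less than \<open>d\<close>. Since \<open>R f\<close> is a left ideal,
  \<open>x \<circ> (y \<circ> z)\<close> is always the residue of \<open>x y z\<close>, whereas for \<open>x y = w f + v\<close> the product
  \<open>(x \<circ> y) \<circ> z\<close> differs from it by the residue of \<open>w f z\<close>. So a triple associates exactly if
  \<open>w f z\<close> lies in \<open>R f\<close>. A product \<open>x y\<close> of degree exactly \<open>d\<close> has a nonzero constant \<open>w\<close>; hence,
  for \<open>d \<ge> 2\<close>, the right nucleus is the eigenring \<open>E = {z \<in> V. f z \<in> R f}\<close>, and a nonconstant
  element in the left or the middle nucleus would force \<open>E = V\<close>. As soon as \<open>E\<close> is smaller
  than \<open>V\<close>, these two nuclei are therefore the constants \<open>K\<close>, and comparing with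
  \<open>t c = \<sigma>(c) t\<close> shows that the centre is \<open>F\<close>. Everything reduces to \<open>|E| = q\<^sup>d\<close>.
  (For \<open>n = d = 1\<close> the semifield is just the field \<open>K = F\<close>.)

  Irreducibility of \<open>f\<close> says that \<open>V\<close> is a simple left \<open>R\<close>-module, and right multiplication
  identifies \<open>E\<close> with the endomorphisms of this module. By Schur's lemma \<open>E\<close> is a finite
  division ring, hence commutative by Wedderburn's theorem (\<open>wedderburn_little\<close>). If \<open>A\<close> is the
  ring of maps by which \<open>R\<close> acts on \<open>V\<close>, Jacobson's density argument gives a number \<open>k\<close> with
  \<open>|A| = |V|\<^sup>k\<close> and \<open>|V| = |E|\<^sup>k\<close> (\<open>card_simple_module\<close>) and shows that every additive map
  commuting with \<open>E\<close> belongs to \<open>A\<close> (\<open>double_commutant\<close>). In particular the commutative \<open>E\<close> is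
  the centre of \<open>A\<close>.

  The annihilator of \<open>V\<close> is \<open>R h\<close> for some monic \<open>h\<close>, so \<open>|A| = q\<^bsup>n N\<^esup>\<close> with \<open>N = deg h\<close>. Because
  \<open>h\<close> has a nonzero constant term, \<open>\<sigma>\<^sup>N\<close> is the identity, and elements of degree below \<open>N\<close> are
  central modulo \<open>R h\<close> only if they are central in \<open>R\<close>. The latter are the polynomials in
  \<open>t\<^sup>n\<close> over \<open>F\<close>, \<open>n\<close> being the order of \<open>\<sigma>\<close>. So \<open>N = n e\<close> and \<open>|E| = q\<^sup>e\<close>. Comparing exponents,
  \<open>n d = e k\<close> and \<open>n N = n d k\<close>, whence \<open>n\<^sup>2 = k\<^sup>2\<close> and \<open>e = d\<close> (\<open>card_eigenring\<close>). That the order of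
  \<open>\<sigma>\<close> is \<open>n\<close> comes out of the same counting for the modulus \<open>t - 1\<close>, whose eigenring is \<open>F\<close>
  (\<open>automorphism_order\<close>).
\<close>

section \<open>Values of cyclotomic polynomials\<close>

text \<open>
  Division by a monic polynomial needs no denominators: comparing coefficients from the top
  down expresses each coefficient of the quotient by integers.
\<close>

lemma coeff_Ints_cofactor_of_monic:
  fixes p q :: "'a::idom poly"
  assumes monic: "lead_coeff p = 1"
    and p: "\<And>i. coeff p i \<in> \<int>" and pq: "\<And>i. coeff (p * q) i \<in> \<int>"
  shows "coeff q i \<in> \<int>"
proof (induction "degree q + 1 - i" arbitrary: i rule: less_induct)
  case less
  show ?case
  proof (cases "i > degree q")
    case True
    then show ?thesis by (simp add: coeff_eq_0)
  next
    case False
    let ?d = "degree p"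
    have "coeff (p * q) (?d + i) = (\<Sum>k\<le>?d + i. coeff p k * coeff q (?d + i - k))"
      by (rule coeff_mult)
    also have "\<dots> = (\<Sum>k\<le>?d. coeff p k * coeff q (?d + i - k))"
      by (rule sum.mono_neutral_right) (auto simp: coeff_eq_0)
    also have "\<dots> = (\<Sum>k<?d. coeff p k * coeff q (?d + i - k)) + coeff q i"
      using monic by (simp flip: lessThan_Suc_atMost)
    finally have eq: "coeff q i = coeff (p * q) (?d + i) -
        (\<Sum>k<?d. coeff p k * coeff q (?d + i - k))"
      by simp
    have "coeff q (?d + i - k) \<in> \<int>" if "k < ?d" for k
      using that False by (intro less) auto
    then show ?thesis
      unfolding eq by (intro Ints_diff Ints_sum Ints_mult pq p) auto
  qed
qed

definition primitive_roots :: "nat \<Rightarrow> complex set" where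
  "primitive_roots N = {z. z ^ N = 1 \<and> (\<forall>k. 0 < k \<longrightarrow> k < N \<longrightarrow> z ^ k \<noteq> 1)}"

text \<open>
  Defined by its complex roots, because the size of its values at integers is read off from
  them; that its coefficients are integers is then a lemma.
\<close>

definition cyclotomic :: "nat \<Rightarrow> complex poly" where
  "cyclotomic N = (\<Prod>z\<in>primitive_roots N. [:-z, 1:])"

lemma unity_poly_eq_prod:
  assumes "N > 0"
  shows "monom 1 N - 1 = (\<Prod>z | z ^ N = 1. [:-z, 1 :: complex:])"
proof -
  let ?p = "monom 1 N - 1 :: complex poly"
  have root: "poly ?p z = 0 \<longleftrightarrow> z ^ N = 1" for z by (simp add: poly_monom)
  have "rsquarefree ?p"
    using assms
    by (auto simp: rsquarefree_roots pderiv_diff pderiv_monom poly_monom power_0_left)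
  moreover have "degree ?p = N"
    using assms by (intro antisym degree_diff_le le_degree) (auto simp: degree_monom_le)
  then have "lead_coeff ?p = 1" using assms by simp
  ultimately show ?thesis
    using complex_poly_decompose_rsquarefree[of ?p] by (simp only: root smult_1_left)
qed

lemma lead_coeff_prod_linear: "lead_coeff (\<Prod>z\<in>A. [:-z, 1 :: complex:]) = 1"
  by (simp add: lead_coeff_prod)

lemma finite_unity_roots: "N > 0 \<Longrightarrow> finite {z :: complex. z ^ N = 1}"
  by (rule finite_roots_unity) simp

lemma order_of_root_of_unity:
  fixes z :: complex
  assumes "z ^ N = 1" "N > 0"
  obtains k where "k > 0" "k dvd N" "z \<in> primitive_roots k"
proof -
  define k where "k = (LEAST k. k > 0 \<and> z ^ k = 1)"
  have k: "k > 0" "z ^ k = 1"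
    using LeastI[of "\<lambda>k. k > 0 \<and> z ^ k = 1" N] assms by (auto simp: k_def)
  have least: "z ^ j \<noteq> 1" if "0 < j" "j < k" for j
    using not_less_Least[of j "\<lambda>k. k > 0 \<and> z ^ k = 1"] that by (auto simp: k_def)
  have "z ^ (k * (N div k) + N mod k) = 1" using assms by simp
  then have "z ^ (N mod k) = 1" using k by (simp only: power_add power_mult) simp
  then have "N mod k = 0" using least[of "N mod k"] k by auto
  then show ?thesis using that[of k] k least by (auto simp: primitive_roots_def)
qed

lemma primitive_roots_disjoint:
  assumes "j > 0" "k > 0" "j \<noteq> k"
  shows "primitive_roots j \<inter> primitive_roots k = {}"
  using assms by (auto simp: primitive_roots_def) (metis linorder_neqE_nat)

lemma nonprimitive_roots_eq:
  assumes "N > 0"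
  shows "{z. z ^ N = 1} - primitive_roots N = (\<Union>k\<in>{k. k dvd N \<and> k < N}. primitive_roots k)"
    (is "?L = ?R")
proof (intro equalityI subsetI)
  fix z assume "z \<in> ?L"
  then obtain k where k: "k > 0" "k dvd N" "z \<in> primitive_roots k" "k \<noteq> N"
    using order_of_root_of_unity[of z N] assms by blast
  then have "k < N" using assms dvd_imp_le by fastforce
  then show "z \<in> ?R" using k by blast
next
  fix z assume "z \<in> ?R"
  then obtain k where k: "k dvd N" "k < N" "z \<in> primitive_roots k" by blast
  then have "k > 0" using assms by (auto intro: Nat.gr0I)
  moreover have "z ^ N = 1" using k by (auto simp: primitive_roots_def power_mult elim!: dvdE)
  ultimately show "z \<in> ?L" using primitive_roots_disjoint[of k N] k assms by auto
qed

lemma coeff_unity_poly_Ints: "coeff (monom 1 N - 1 :: complex poly) i \<in> \<int>"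
  by (simp add: coeff_1)

lemma coeff_prod_Ints:
  assumes "\<And>x i. x \<in> A \<Longrightarrow> coeff (g x) i \<in> \<int>"
  shows "coeff (prod g A :: complex poly) i \<in> \<int>"
  using assms
proof (induction A arbitrary: i rule: infinite_finite_induct)
  case (insert x A)
  then show ?case by (auto simp: coeff_mult intro!: Ints_sum Ints_mult)
qed (simp_all add: coeff_1)

lemma finite_primitive_roots: "N > 0 \<Longrightarrow> finite (primitive_roots N)"
  by (rule finite_subset[OF _ finite_unity_roots]) (auto simp: primitive_roots_def)

text \<open>
  Sorting the \<open>N\<close>-th roots of unity by their exact order writes \<open>x\<^sup>N - 1\<close> as the product of the
  cyclotomic polynomials of the divisors of \<open>N\<close>. By induction the factors for proper divisors are
  integral, and they are monic, so the remaining factor is integral as well.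
\<close>

lemma coeff_cyclotomic_Ints:
  assumes "N > 0"
  shows "coeff (cyclotomic N) i \<in> \<int>"
  using assms
proof (induction N arbitrary: i rule: less_induct)
  case (less N)
  let ?D = "{k. k dvd N \<and> k < N}"
  have pos: "k > 0" if "k \<in> ?D" for k using that less.prems by (auto intro: Nat.gr0I)
  define P where "P = (\<Prod>z\<in>{z. z ^ N = 1} - primitive_roots N. [:-z, 1 :: complex:])"
  have "P = (\<Prod>k\<in>?D. cyclotomic k)"
    unfolding P_def nonprimitive_roots_eq[OF less.prems] cyclotomic_def
    using pos by (intro prod.UNION_disjoint ballI)
      (auto intro: finite_primitive_roots dest!: primitive_roots_disjoint)
  then have "coeff P i \<in> \<int>" for i using less.IH pos by (auto intro!: coeff_prod_Ints)
  moreover have "P * cyclotomic N = monom 1 N - 1"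
    unfolding unity_poly_eq_prod[OF less.prems] P_def cyclotomic_def
    by (rule prod.subset_diff[symmetric])
      (auto simp: primitive_roots_def intro: finite_unity_roots less.prems)
  ultimately show ?case
    using coeff_Ints_cofactor_of_monic[of P "cyclotomic N"]
    by (simp add: P_def lead_coeff_prod_linear coeff_unity_poly_Ints)
qed

lemma poly_of_nat_Ints:
  fixes p :: "complex poly"
  assumes "\<And>i. coeff p i \<in> \<int>" shows "poly p (of_nat Q) \<in> \<int>"
  unfolding poly_altdef by (intro Ints_sum Ints_mult assms Ints_power) auto

text \<open>
  The number-theoretic core of Wedderburn's theorem. The witness is the value at \<open>Q\<close> of the
  \<open>N\<close>-th cyclotomic polynomial: it divides \<open>(Q\<^sup>N - 1) / (Q\<^sup>k - 1)\<close> since the primitive \<open>N\<close>-th roots of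
  unity are not among the roots of \<open>x\<^sup>k - 1\<close>, and it is larger than \<open>Q - 1\<close> since every root of
  unity other than 1 has distance more than \<open>Q - 1\<close> from \<open>Q\<close>.
\<close>

lemma cyclotomic_divisor:
  fixes Q N :: nat
  assumes Q: "Q \<ge> 2" and N: "N \<ge> 2"
  obtains g :: int where "\<bar>g\<bar> > int Q - 1" "g dvd int Q ^ N - 1"
    "\<And>k m. k dvd N \<Longrightarrow> k < N \<Longrightarrow> m * (int Q ^ k - 1) = int Q ^ N - 1 \<Longrightarrow> g dvd m"
proof -
  have N0: "N > 0" using N by simp
  obtain g :: int where g: "poly (cyclotomic N) (of_nat Q) = of_int g"
    using poly_of_nat_Ints[OF coeff_cyclotomic_Ints[OF N0]] by (auto elim: Ints_cases)
  have factor: "\<exists>h. (int Q ^ N - 1) = (int Q ^ k - 1) * (g * h)" if k: "k dvd N" "k < N" for k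
  proof -
    have k0: "k > 0" using k N0 by (auto intro: Nat.gr0I)
    \<comment> \<open>The product over the \<open>N\<close>-th roots of unity that are neither primitive nor \<open>k\<close>-th roots of unity.\<close>
    define T where "T = (\<Prod>z\<in>{z. z ^ N = 1} - primitive_roots N - {z. z ^ k = 1}. [:-z, 1 :: complex:])"
    have sub: "{z :: complex. z ^ k = 1} \<subseteq> {z. z ^ N = 1} - primitive_roots N"
      using k k0 by (auto simp: primitive_roots_def power_mult elim!: dvdE)
    have "monom 1 N - 1 = (\<Prod>z\<in>{z. z ^ N = 1} - primitive_roots N. [:-z, 1:]) * cyclotomic N"
      unfolding unity_poly_eq_prod[OF N0] cyclotomic_def
      by (rule prod.subset_diff) (auto simp: primitive_roots_def intro: finite_unity_roots N0)
    also have "(\<Prod>z\<in>{z. z ^ N = 1} - primitive_roots N. [:-z, 1 :: complex:]) = T * (monom 1 k - 1)"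
      unfolding T_def unity_poly_eq_prod[OF k0]
      by (rule prod.subset_diff[OF sub]) (auto intro: finite_unity_roots N0)
    finally have eq: "monom 1 N - 1 = ((monom 1 k - 1) * cyclotomic N) * T" by simp
    have lead: "lead_coeff ((monom 1 k - 1 :: complex poly) * cyclotomic N) = 1"
      unfolding lead_coeff_mult unity_poly_eq_prod[OF k0] cyclotomic_def
      by (simp only: lead_coeff_prod_linear mult_1)
    have "coeff ((monom 1 k - 1) * cyclotomic N) i \<in> \<int>" for i
      by (auto simp: coeff_mult intro!: Ints_sum Ints_mult coeff_cyclotomic_Ints N0
          coeff_unity_poly_Ints simp del: coeff_diff)
    then have "coeff T i \<in> \<int>" for i
      using coeff_Ints_cofactor_of_monic[OF lead] eq coeff_unity_poly_Ints by metis
    then obtain h :: int where h: "poly T (of_nat Q) = of_int h"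
      using poly_of_nat_Ints by (metis Ints_cases)
    have "of_int (int Q ^ N - 1) = (of_int ((int Q ^ k - 1) * (g * h)) :: complex)"
      using arg_cong[OF eq, of "\<lambda>p. poly p (of_nat Q)"] g h by (simp add: poly_monom)
    then show ?thesis by (metis of_int_eq_iff)
  qed
  have "g dvd int Q ^ N - 1"
    using factor[of 1] N by (auto intro: dvd_mult)
  moreover have "g dvd m" if "k dvd N" "k < N" "m * (int Q ^ k - 1) = int Q ^ N - 1" for k m
  proof -
    have "k > 0" using that N0 by (auto intro: Nat.gr0I)
    then have "int Q ^ k > 1" using Q by (intro one_less_power) auto
    then have nz: "int Q ^ k - 1 \<noteq> 0" by simp
    have "\<exists>h. int Q ^ N - 1 = (int Q ^ k - 1) * (g * h)" using factor that by blast
    then obtain h where "int Q ^ N - 1 = (int Q ^ k - 1) * (g * h)" by blast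
    then have "m = g * h" using that nz by (metis mult.commute mult_cancel_left)
    then show ?thesis by simp
  qed
  moreover have "\<bar>g\<bar> > int Q - 1"
  proof -
    have far: "norm (of_nat Q - z) > real Q - 1" if "z \<in> primitive_roots N" for z
    proof -
      have z: "z ^ N = 1" "z \<noteq> 1"
        using that N by (auto simp: primitive_roots_def dest: spec[of _ 1])
      then have norm1: "norm z = 1"
        using N0 by (metis norm_one norm_power power_eq_1_iff norm_ge_zero less_irrefl)
      have "Re z \<noteq> 1"
      proof
        assume "Re z = 1"
        moreover have "(Re z)\<^sup>2 + (Im z)\<^sup>2 = 1" using norm1 by (simp add: cmod_power2[symmetric])
        ultimately have "z = 1" by (simp add: complex_eq_iff)
        with z show False by simp
      qed
      then have "Re z < 1" using complex_Re_le_cmod[of z] norm1 by linarith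
      then have "Re (of_nat Q - z) > real Q - 1" by simp
      then show ?thesis using complex_Re_le_cmod[of "of_nat Q - z"] by linarith
    qed
    have "cis (2 * pi / N) \<in> primitive_roots N"
    proof -
      have "cis (2 * pi / N) ^ k \<noteq> 1" if k: "0 < k" "k < N" for k
      proof
        assume "cis (2 * pi / N) ^ k = 1"
        then have "cos (real k * (2 * pi / N)) = 1"
          by (simp add: DeMoivre complex_eq_iff)
        then obtain x :: int where "real k * (2 * pi / N) = x * 2 * pi"
          by (auto simp: cos_one_2pi_int)
        then have "real k = x * real N" using N0 by (simp add: field_simps)
        then have "int k = x * int N" by (metis of_int_eq_iff of_int_mult of_int_of_nat_eq)
        then have "int N dvd int k" by simp
        then show False using k by (simp add: nat_dvd_not_less)
      qed
      moreover have "cis (2 * pi / N) ^ N = 1" using N0 by (simp add: DeMoivre)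
      ultimately show ?thesis by (simp add: primitive_roots_def)
    qed
    then have ne: "primitive_roots N \<noteq> {}" by blast
    have fin: "finite (primitive_roots N)" by (rule finite_primitive_roots[OF N0])
    obtain z where z: "z \<in> primitive_roots N" using ne by blast
    have "1 \<le> (\<Prod>z\<in>primitive_roots N - {z}. norm (of_nat Q - z))"
      using far Q by (intro prod_ge_1) fastforce
    then have "real Q - 1 < norm (of_nat Q - z) * (\<Prod>z\<in>primitive_roots N - {z}. norm (of_nat Q - z))"
      using far[OF z] Q mult_left_mono[of 1 _ "norm (of_nat Q - z)"] by fastforce
    also have "\<dots> = (\<Prod>z\<in>primitive_roots N. norm (of_nat Q - z))"
      by (rule prod.remove[OF fin z, symmetric])
    also have "\<dots> = norm (poly (cyclotomic N) (of_nat Q))"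
      by (simp add: cyclotomic_def poly_prod prod_norm)
    also have "\<dots> = real_of_int \<bar>g\<bar>" by (simp add: g)
    finally show ?thesis by linarith
  qed
  ultimately show thesis by (intro that) auto
qed

section \<open>Finite division rings\<close>

context ring
begin

text \<open>
  \<open>W\<close> is a left vector space over the division ring \<open>S\<close>, so its size is a power of that of \<open>S\<close>.
  A subspace that is maximal among those whose size is such a power must be all of \<open>W\<close>, because
  adjoining one more vector multiplies the size by \<open>|S|\<close>. This is stated for subsets of an ambient
  ring, as it is applied to centralizers over the centre and to the ring over a centralizer.
\<close>

lemma card_eq_power_of_division_subring:
  assumes fin: "finite (carrier R)"
    and S: "S \<subseteq> carrier R" "\<zero> \<in> S" "\<one> \<in> S" "\<And>a b. a \<in> S \<Longrightarrow> b \<in> S \<Longrightarrow> a \<ominus> b \<in> S"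
      "\<And>a b. a \<in> S \<Longrightarrow> b \<in> S \<Longrightarrow> a \<otimes> b \<in> S"
    and S_inv: "\<And>a. a \<in> S \<Longrightarrow> a \<noteq> \<zero> \<Longrightarrow> a \<in> Units R \<and> inv a \<in> S"
    and W: "W \<subseteq> carrier R" "\<zero> \<in> W" "\<And>u w. u \<in> W \<Longrightarrow> w \<in> W \<Longrightarrow> u \<oplus> w \<in> W"
      "\<And>a w. a \<in> S \<Longrightarrow> w \<in> W \<Longrightarrow> a \<otimes> w \<in> W"
  shows "\<exists>k. card W = card S ^ k"
proof -
  define sub where "sub = (\<lambda>U. U \<subseteq> W \<and> \<zero> \<in> U \<and>
    (\<forall>u\<in>U. \<forall>w\<in>U. u \<ominus> w \<in> U) \<and> (\<forall>a\<in>S. \<forall>u\<in>U. a \<otimes> u \<in> U) \<and> (\<exists>k. card U = card S ^ k))"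
  have finW: "finite W" using fin W(1) finite_subset by blast
  have "sub {\<zero>}"
    using W S by (auto simp: sub_def minus_eq intro: exI[of _ 0])
  moreover have "finite {U. sub U}"
    using finW by (rule_tac finite_subset[of _ "Pow W"]) (auto simp: sub_def)
  ultimately obtain U where U: "sub U" and maxU: "\<And>U'. sub U' \<Longrightarrow> U \<subseteq> U' \<Longrightarrow> U = U'"
    using finite_has_maximal[of "{U. sub U}"] by blast
  obtain k where k: "card U = card S ^ k" using U by (auto simp: sub_def)
  have UR: "u \<in> carrier R" if "u \<in> U" for u using that U W(1) by (auto simp: sub_def)
  have "W \<subseteq> U"
  proof (rule ccontr)
    assume "\<not> W \<subseteq> U"
    then obtain w where w: "w \<in> W" "w \<notin> U" by blast
    have wR: "w \<in> carrier R" using w W by blast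
    define U' where "U' = (\<lambda>(u, a). u \<oplus> a \<otimes> w) ` (U \<times> S)"
    have inj: "inj_on (\<lambda>(u, a). u \<oplus> a \<otimes> w) (U \<times> S)"
    proof (rule inj_onI, clarify)
      fix u a u' a'
      assume *: "u \<in> U" "a \<in> S" "u' \<in> U" "a' \<in> S" "u \<oplus> a \<otimes> w = u' \<oplus> a' \<otimes> w"
      then have R: "u \<in> carrier R" "a \<in> carrier R" "u' \<in> carrier R" "a' \<in> carrier R"
        using UR S by auto
      have "a \<otimes> w = \<ominus> u \<oplus> (u \<oplus> a \<otimes> w)" using R wR by (simp add: r_neg1)
      also have "\<dots> = (u' \<ominus> u) \<oplus> a' \<otimes> w" unfolding *(5) using R wR by (simp add: minus_eq a_ac)
      finally have "(a \<ominus> a') \<otimes> w = ((u' \<ominus> u) \<oplus> a' \<otimes> w) \<oplus> \<ominus> (a' \<otimes> w)"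
        using R wR by (simp add: minus_eq l_distr l_minus)
      also have "\<dots> = u' \<ominus> u" using R wR by (simp add: a_assoc r_neg)
      finally have "(a \<ominus> a') \<otimes> w = u' \<ominus> u" .
      moreover have "u' \<ominus> u \<in> U" using * U by (auto simp: sub_def)
      ultimately have in_U: "(a \<ominus> a') \<otimes> w \<in> U" by simp
      have "a = a'"
      proof (rule ccontr)
        assume "a \<noteq> a'"
        have "(a \<ominus> a') \<oplus> a' = a" using R by (simp add: minus_eq a_assoc l_neg)
        with \<open>a \<noteq> a'\<close> R have nz: "a \<ominus> a' \<noteq> \<zero>" by auto
        have "a \<ominus> a' \<in> S" using S * by blast
        with S_inv nz have i: "a \<ominus> a' \<in> Units R" "inv (a \<ominus> a') \<in> S" by auto
        then have "inv (a \<ominus> a') \<otimes> ((a \<ominus> a') \<otimes> w) \<in> U" using in_U U by (auto simp: sub_def)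
        moreover have "inv (a \<ominus> a') \<otimes> ((a \<ominus> a') \<otimes> w) = w"
          using i wR R by (metis Units_closed Units_inv_closed Units_l_inv l_one m_assoc)
        ultimately show False using w by simp
      qed
      then show "u = u' \<and> a = a'" using * R wR by simp
    qed
    have "card U' = card S ^ Suc k"
      unfolding U'_def by (simp add: card_image[OF inj] card_cartesian_product k)
    moreover have "U' \<subseteq> W"
      using U W w by (auto simp: U'_def sub_def)
    moreover have "\<zero> \<in> U'"
      using U S wR unfolding U'_def sub_def by (intro image_eqI[of _ _ "(\<zero>, \<zero>)"]) auto
    moreover have "x \<ominus> y \<in> U'" if xU: "x \<in> U'" and yU: "y \<in> U'" for x y
    proof -
      obtain u a where 1: "u \<in> U" "a \<in> S" "x = u \<oplus> a \<otimes> w"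
        using xU by (auto simp: U'_def)
      obtain u' a' where 2: "u' \<in> U" "a' \<in> S" "y = u' \<oplus> a' \<otimes> w"
        using yU by (auto simp: U'_def)
      note * = 1 2
      then have R: "u \<in> carrier R" "a \<in> carrier R" "u' \<in> carrier R" "a' \<in> carrier R"
        using UR S by auto
      have "x \<ominus> y = (u \<ominus> u') \<oplus> (a \<ominus> a') \<otimes> w"
        using R wR * by (simp add: minus_eq l_distr a_ac l_minus minus_add)
      moreover have "u \<ominus> u' \<in> U" "a \<ominus> a' \<in> S" using * U S by (auto simp: sub_def)
      ultimately show ?thesis by (auto simp: U'_def)
    qed
    moreover have "a \<otimes> x \<in> U'" if aS: "a \<in> S" and xU: "x \<in> U'" for a x
    proof -
      obtain u b where *: "u \<in> U" "b \<in> S" "x = u \<oplus> b \<otimes> w" using xU by (auto simp: U'_def)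
      moreover have "a \<in> carrier R" "b \<in> carrier R" "u \<in> carrier R"
        using * aS UR S by auto
      ultimately have "a \<otimes> x = a \<otimes> u \<oplus> (a \<otimes> b) \<otimes> w"
        using wR by (simp add: r_distr m_assoc)
      moreover have "a \<otimes> u \<in> U" "a \<otimes> b \<in> S" using * aS U S by (auto simp: sub_def)
      ultimately show ?thesis by (auto simp: U'_def)
    qed
    ultimately have "sub U'" unfolding sub_def by blast
    moreover have "U \<subseteq> U'"
    proof
      fix u assume "u \<in> U"
      then show "u \<in> U'"
        unfolding U'_def using UR S wR by (intro image_eqI[of _ _ "(u, \<zero>)"]) auto
    qed
    ultimately have "U = U'" by (rule maxU)
    moreover have "w \<in> U'"
    proof -
      have "w = \<zero> \<oplus> \<one> \<otimes> w" using wR by simp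
      moreover have "\<one> \<in> S" by (rule S)
      moreover have "\<zero> \<in> U" using U by (simp add: sub_def)
      ultimately show ?thesis by (force simp: U'_def image_iff)
    qed
    ultimately show False using w by simp
  qed
  then have "U = W" using U by (auto simp: sub_def)
  with k show ?thesis by auto
qed

text \<open>
  Witt's proof. Let \<open>Q\<close> be the size of the centre and \<open>Q\<^sup>N\<close> that of the ring. The centralizer of a
  noncentral element has size \<open>Q\<^sup>k\<close> for a proper divisor \<open>k\<close> of \<open>N\<close>, so its conjugacy class has
  \<open>(Q\<^sup>N - 1) / (Q\<^sup>k - 1)\<close> elements. If \<open>N > 1\<close>, the number \<open>g\<close> of \<open>cyclotomic_divisor\<close> divides
  all these class sizes and \<open>Q\<^sup>N - 1\<close>, hence by the class equation also \<open>Q - 1\<close>, for which it is too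
  large.
\<close>

lemma wedderburn_little:
  assumes fin: "finite (carrier R)" and units: "Units R = carrier R - {\<zero>}"
    and xy: "x \<in> carrier R" "y \<in> carrier R"
  shows "x \<otimes> y = y \<otimes> x"
proof -
  define C where "C = (\<lambda>x. {c \<in> carrier R. c \<otimes> x = x \<otimes> c})"
  define Z where "Z = {z \<in> carrier R. \<forall>c\<in>carrier R. c \<otimes> z = z \<otimes> c}"
  have one_zero: "\<one> \<noteq> \<zero>" using units by (metis DiffD2 Units_one_closed singletonI)
  have Csub: "C x \<subseteq> carrier R" for x by (auto simp: C_def)
  have C_diff: "a \<ominus> b \<in> C x" if "x \<in> carrier R" "a \<in> C x" "b \<in> C x" for x a b
    using that by (auto simp: C_def minus_eq l_distr r_distr l_minus r_minus)
  have C_mult: "a \<otimes> b \<in> C x" if "x \<in> carrier R" "a \<in> C x" "b \<in> C x" for x a b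
  proof -
    have *: "a \<in> carrier R" "b \<in> carrier R" "a \<otimes> x = x \<otimes> a" "b \<otimes> x = x \<otimes> b"
      using that by (auto simp: C_def)
    have "a \<otimes> b \<otimes> x = a \<otimes> (x \<otimes> b)" using * that(1) by (simp add: m_assoc)
    also have "\<dots> = x \<otimes> (a \<otimes> b)" using * that(1) by (simp flip: m_assoc)
    finally show ?thesis using * by (simp add: C_def)
  qed
  have C_inv: "a \<in> Units R \<and> inv a \<in> C x"
    if "x \<in> carrier R" "a \<in> C x" "a \<noteq> \<zero>" for x a
  proof -
    have a: "a \<in> Units R" "a \<otimes> x = x \<otimes> a" using that units by (auto simp: C_def)
    have R: "a \<in> carrier R" "inv a \<in> carrier R" using a by auto
    have "x \<otimes> inv a = inv a \<otimes> (a \<otimes> x) \<otimes> inv a"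
      using a(1) R that(1) by (simp flip: m_assoc)
    also have "\<dots> = inv a \<otimes> x" unfolding a(2) using a(1) R that(1) by (simp add: m_assoc)
    finally have "inv a \<otimes> x = x \<otimes> inv a" ..
    then show ?thesis using a by (simp add: C_def)
  qed
  have Z_C: "Z \<subseteq> C x" "\<zero> \<in> C x" "\<one> \<in> C x" if "x \<in> carrier R" for x
    using that by (auto simp: Z_def C_def)
  have Z_eq: "Z = carrier R \<inter> (\<Inter>x\<in>carrier R. C x)" by (auto simp: Z_def C_def)
  have Z_diff: "a \<ominus> b \<in> Z" if "a \<in> Z" "b \<in> Z" for a b
    using that C_diff unfolding Z_eq by auto
  have Z_mult: "a \<otimes> b \<in> Z" if "a \<in> Z" "b \<in> Z" for a b
    using that C_mult unfolding Z_eq by auto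
  have Z_inv: "a \<in> Units R \<and> inv a \<in> Z" if "a \<in> Z" "a \<noteq> \<zero>" for a
    using that C_inv zero_closed unfolding Z_eq by auto
  define Q where "Q = card Z"
  have finZ: "finite Z" using fin by (simp add: Z_def)
  have "{\<zero>, \<one>} \<subseteq> Z" by (auto simp: Z_def)
  then have "card {\<zero>, \<one>} \<le> Q" unfolding Q_def by (rule card_mono[OF finZ])
  then have Q2: "Q \<ge> 2" using one_zero by simp
  have Zsub: "Z \<subseteq> carrier R" by (auto simp: Z_def)
  have Z01: "\<zero> \<in> Z" "\<one> \<in> Z" by (auto simp: Z_def)
  have "\<exists>N. card (carrier R) = card Z ^ N"
    by (rule card_eq_power_of_division_subring[OF fin Zsub Z01 Z_diff Z_mult Z_inv])
      (use Zsub in auto)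
  then obtain N where N: "card (carrier R) = Q ^ N" unfolding Q_def by blast
  have cent: "\<exists>k. card (C x) = Q ^ k \<and> k dvd N" if x: "x \<in> carrier R" for x
  proof -
    note CD = C_diff[OF x] and CM = C_mult[OF x] and CI = C_inv[OF x] and ZC = Z_C[OF x]
    have CP: "a \<oplus> b \<in> C x" if "a \<in> C x" "b \<in> C x" for a b
      using that x by (auto simp: C_def l_distr r_distr)
    have "\<exists>k. card (C x) = card Z ^ k"
      by (rule card_eq_power_of_division_subring[OF fin Zsub Z01 Z_diff Z_mult Z_inv Csub ZC(2) CP CM])
        (use ZC(1) in blast)+
    then obtain k where k: "card (C x) = Q ^ k" unfolding Q_def by blast
    have "\<exists>j. card (carrier R) = card (C x) ^ j"
      by (rule card_eq_power_of_division_subring[OF fin Csub ZC(2,3) CD CM CI])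
        (use Csub[of x] in auto)
    \<comment> \<open>The ring is also a vector space over the centralizer, which is why \<open>k\<close> divides \<open>N\<close>.\<close>
    then obtain j where "Q ^ N = (Q ^ k) ^ j" using k N by auto
    then have "N = k * j" using Q2 by (simp flip: power_mult)
    with k show ?thesis by auto
  qed
  define G where "G = units_of R"
  interpret G: group G unfolding G_def by (rule units_group)
  define act where "act = (\<lambda>g. \<lambda>h\<in>carrier G. g \<otimes>\<^bsub>G\<^esub> h \<otimes>\<^bsub>G\<^esub> inv\<^bsub>G\<^esub> g)"
  interpret act: group_action G "carrier G" act
    unfolding act_def by (rule G.action_by_conjugation)
  have carG: "carrier G = carrier R - {\<zero>}" unfolding G_def units_of_def using units by simp
  have finG: "finite (carrier G)" using fin carG by simp
  have orderG: "order G = Q ^ N - 1"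
    using fin N by (simp add: order_def carG card_Diff_singleton)
  have stab: "stabilizer G act x = C x - {\<zero>}" if x: "x \<in> carrier G" for x
  proof -
    have "g \<otimes>\<^bsub>G\<^esub> x \<otimes>\<^bsub>G\<^esub> inv\<^bsub>G\<^esub> g = x \<longleftrightarrow> g \<otimes> x = x \<otimes> g" if g: "g \<in> carrier G" for g
    proof -
      have "g \<otimes>\<^bsub>G\<^esub> x \<otimes>\<^bsub>G\<^esub> inv\<^bsub>G\<^esub> g = x \<longleftrightarrow> g \<otimes>\<^bsub>G\<^esub> x = x \<otimes>\<^bsub>G\<^esub> g"
        using g x by (metis G.inv_solve_right G.m_closed)
      then show ?thesis by (simp add: G_def units_of_def)
    qed
    then show ?thesis using x by (auto simp: stabilizer_def act_def C_def carG)
  qed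
  have "N \<le> 1"
  proof (rule ccontr)
    assume "\<not> N \<le> 1"
    then have N2: "N \<ge> 2" by simp
    obtain g where g: "\<bar>g\<bar> > int Q - 1" "g dvd int Q ^ N - 1"
      "\<And>k m. k dvd N \<Longrightarrow> k < N \<Longrightarrow> m * (int Q ^ k - 1) = int Q ^ N - 1 \<Longrightarrow> g dvd m"
      using cyclotomic_divisor[OF Q2 N2] by blast
    have orb_dvd: "nat \<bar>g\<bar> dvd card (orbit G act x)" if x: "x \<in> carrier G - Z" for x
    proof -
      have xR: "x \<in> carrier R" using x carG by auto
      obtain k where k: "card (C x) = Q ^ k" "k dvd N" using cent[OF xR] by blast
      have "C x \<noteq> carrier R" using x xR by (auto simp: Z_def C_def)
      then have "card (C x) < card (carrier R)"
        by (intro psubset_card_mono fin) (use Csub in blast)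
      then have "k < N" using k N Q2 by simp
      moreover have "finite (C x)" using fin Csub finite_subset by blast
      then have "card (stabilizer G act x) = Q ^ k - 1"
        using stab x k Z_C[OF xR] by (simp add: card_Diff_singleton)
      then have "card (orbit G act x) * (Q ^ k - 1) = Q ^ N - 1"
        using act.orbit_stabilizer_theorem[of x] x orderG by simp
      then have "int (card (orbit G act x) * (Q ^ k - 1)) = int (Q ^ N - 1)" by simp
      then have "int (card (orbit G act x)) * (int Q ^ k - 1) = int Q ^ N - 1"
        using Q2 by (simp add: of_nat_diff)
      ultimately have "g dvd int (card (orbit G act x))" using g(3) k(2) by blast
      then show ?thesis by (simp add: nat_abs_dvd_iff)
    qed
    define Cl where "Cl = orbit G act ` (carrier G - Z)"
    have orb_sub: "orbit G act x \<subseteq> carrier G - Z" if x: "x \<in> carrier G - Z" for x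
    proof
      fix y assume y: "y \<in> orbit G act x"
      have yG: "y \<in> carrier G" using y x act.element_image by (auto simp: orbit_def)
      moreover have "y \<notin> Z"
      proof
        assume "y \<in> Z"
        then have "stabilizer G act y = carrier G"
          using stab[OF yG] by (auto simp: C_def Z_def carG)
        then have "act g y = y" if "g \<in> carrier G" for g
          using that by (auto simp: stabilizer_def)
        moreover have "x \<in> orbit G act y" using act.orbit_sym[of x y] x yG y by blast
        ultimately have "x = y" by (auto simp: orbit_def)
        with \<open>y \<in> Z\<close> x show False by simp
      qed
      ultimately show "y \<in> carrier G - Z" by simp
    qed
    have Un: "\<Union> Cl = carrier G - Z"
      unfolding Cl_def using orb_sub act.orbit_refl by blast
    have "nat \<bar>g\<bar> dvd card (\<Union> Cl)"
    proof (rule dvd_partition)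
      show "finite (\<Union> Cl)" unfolding Un using finG by simp
      show "\<forall>c\<in>Cl. nat \<bar>g\<bar> dvd card c" using orb_dvd by (auto simp: Cl_def)
      show "\<forall>c1\<in>Cl. \<forall>c2\<in>Cl. c1 \<noteq> c2 \<longrightarrow> c1 \<inter> c2 = {}"
      proof (intro ballI impI)
        fix c1 c2 assume "c1 \<in> Cl" "c2 \<in> Cl" "c1 \<noteq> c2"
        then have "c1 \<in> orbits G (carrier G) act" "c2 \<in> orbits G (carrier G) act"
          by (auto simp: Cl_def orbits_def)
        with \<open>c1 \<noteq> c2\<close> show "c1 \<inter> c2 = {}" using act.disjoint_union by blast
      qed
    qed
    then have "g dvd int (card (carrier G - Z))" by (simp add: Un nat_abs_dvd_iff)
    moreover have "int (card (carrier G - Z)) = (int Q ^ N - 1) - (int Q - 1)"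
    proof -
      have "carrier G - Z = carrier R - Z" by (auto simp: carG Z_def)
      moreover have "Z \<subseteq> carrier R" by (auto simp: Z_def)
      moreover have "card (carrier R - Z) = Q ^ N - Q"
        using card_Diff_subset[OF finZ \<open>Z \<subseteq> carrier R\<close>] N Q_def by simp
      moreover have "Q \<le> Q ^ N" using self_le_power[of Q N] Q2 N2 by simp
      ultimately show ?thesis by (simp add: of_nat_diff)
    qed
    ultimately have "g dvd int Q - 1" using g(2) by (metis dvd_diff_right_iff)
    then have "\<bar>g\<bar> \<le> int Q - 1" using Q2 zdvd_imp_le[of "\<bar>g\<bar>" "int Q - 1"] by simp
    with g(1) show False by simp
  qed
  then have "card (carrier R) \<le> card Z"
    using N Q_def Q2 power_increasing[of N 1 Q] by simp
  moreover have "Z \<subseteq> carrier R" by (auto simp: Z_def)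
  ultimately have "Z = carrier R" using fin by (metis card_seteq)
  then show ?thesis using xy by (auto simp: Z_def)
qed

end

section \<open>Density for finite simple modules\<close>

lemma card_eq_card_image_times_fibre:
  fixes S :: "'b set" and g :: "'b \<Rightarrow> 'c"
  assumes fin: "finite S"
    and fibre: "\<And>y. y \<in> g ` S \<Longrightarrow> card {x \<in> S. g x = y} = m"
  shows "card S = card (g ` S) * m"
proof -
  have "card S = card (\<Union>y\<in>g ` S. {x \<in> S. g x = y})" by (rule arg_cong[of _ _ card]) auto
  also have "\<dots> = (\<Sum>y\<in>g ` S. card {x \<in> S. g x = y})"
    using fin by (intro card_UN_disjoint) auto
  finally show ?thesis using fibre by simp
qed

text \<open>
  Maps are taken extensional on \<open>V\<close>, so that sets of them can be counted.
\<close>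

definition additive_on :: "'v::ab_group_add set \<Rightarrow> ('v \<Rightarrow> 'v) \<Rightarrow> bool" where
  "additive_on V g \<longleftrightarrow> g \<in> V \<rightarrow>\<^sub>E V \<and> (\<forall>u\<in>V. \<forall>v\<in>V. g (u + v) = g u + g v)"

text \<open>
  \<open>A\<close> is the ring of maps through which some ring acts on the finite group \<open>V\<close>. Replacing the acting
  ring by its image makes it finite and the action faithful.
\<close>

locale finite_simple_module =
  fixes V :: "'v::ab_group_add set" and A :: "('v \<Rightarrow> 'v) set"
  assumes finite_V: "finite V" and zero_V: "0 \<in> V"
    and diff_V: "\<And>u v. u \<in> V \<Longrightarrow> v \<in> V \<Longrightarrow> u - v \<in> V"
    and A_additive: "\<And>a. a \<in> A \<Longrightarrow> additive_on V a"
    and A_one: "(\<lambda>v\<in>V. v) \<in> A"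
    and A_diff: "\<And>a b. a \<in> A \<Longrightarrow> b \<in> A \<Longrightarrow> (\<lambda>v\<in>V. a v - b v) \<in> A"
    and A_mult: "\<And>a b. a \<in> A \<Longrightarrow> b \<in> A \<Longrightarrow> (\<lambda>v\<in>V. a (b v)) \<in> A"
    and simple: "\<And>W. W \<subseteq> V \<Longrightarrow> W \<noteq> {} \<Longrightarrow> (\<And>u v. u \<in> W \<Longrightarrow> v \<in> W \<Longrightarrow> u - v \<in> W) \<Longrightarrow>
      (\<And>a v. a \<in> A \<Longrightarrow> v \<in> W \<Longrightarrow> a v \<in> W) \<Longrightarrow> W = {0} \<or> W = V"
begin

definition commutant :: "('v \<Rightarrow> 'v) set" where
  "commutant = {\<delta>. additive_on V \<delta> \<and> (\<forall>a\<in>A. \<forall>v\<in>V. \<delta> (a v) = a (\<delta> v))}"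

definition ann :: "'v set \<Rightarrow> ('v \<Rightarrow> 'v) set" where
  "ann T = {a \<in> A. \<forall>v\<in>T. a v = 0}"

text \<open>
  Jacobson density says that this is the span of \<open>T\<close> over the commutant. Defining it as a double
  annihilator makes it closed under everything that commutes with \<open>A\<close> without mentioning bases.
\<close>

definition ann_closure :: "'v set \<Rightarrow> 'v set" where
  "ann_closure T = {v \<in> V. \<forall>a\<in>ann T. a v = 0}"

lemma add_V: "u \<in> V \<Longrightarrow> v \<in> V \<Longrightarrow> u + v \<in> V"
  using diff_V[of u "0 - v"] diff_V[of 0 v] zero_V by simp

lemma additive_onD:
  assumes "additive_on V g"
  shows "v \<in> V \<Longrightarrow> g v \<in> V" "u \<in> V \<Longrightarrow> v \<in> V \<Longrightarrow> g (u + v) = g u + g v"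
    "u \<in> V \<Longrightarrow> v \<in> V \<Longrightarrow> g (u - v) = g u - g v" "g 0 = 0"
proof -
  show add: "g (u + v) = g u + g v" if "u \<in> V" "v \<in> V" for u v
    using assms that by (auto simp: additive_on_def)
  show "v \<in> V \<Longrightarrow> g v \<in> V" using assms by (auto simp: additive_on_def)
  show "g 0 = 0" using add[OF zero_V zero_V] by simp
  show "g (u - v) = g u - g v" if "u \<in> V" "v \<in> V"
    using add[OF diff_V[OF that] that(2)] by (simp add: algebra_simps)
qed

lemma additive_on_ext:
  assumes "additive_on V g" "additive_on V h" "\<And>v. v \<in> V \<Longrightarrow> g v = h v"
  shows "g = h"
  using assms by (auto simp: additive_on_def intro: PiE_ext)

lemma A_add:
  assumes "a \<in> A" "b \<in> A"
  shows "(\<lambda>v\<in>V. a v + b v) \<in> A"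
proof -
  have z: "(\<lambda>v\<in>V. 0) \<in> A" using A_diff[OF assms(1) assms(1)] by (simp cong: restrict_cong)
  have n: "(\<lambda>v\<in>V. - b v) \<in> A" using A_diff[OF z assms(2)] by (simp cong: restrict_cong)
  show ?thesis using A_diff[OF assms(1) n] by (simp cong: restrict_cong)
qed

lemma A_finite: "finite A"
proof (rule finite_subset)
  show "A \<subseteq> V \<rightarrow>\<^sub>E V" using A_additive by (auto simp: additive_on_def)
  show "finite (V \<rightarrow>\<^sub>E V)" using finite_V by (intro finite_PiE)
qed

lemma commutantD:
  assumes "\<delta> \<in> commutant"
  shows "additive_on V \<delta>" "a \<in> A \<Longrightarrow> v \<in> V \<Longrightarrow> \<delta> (a v) = a (\<delta> v)"
  using assms by (auto simp: commutant_def)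

text \<open>
  The kernel of an endomorphism is a submodule, so it is trivial or everything.
\<close>

lemma schur:
  assumes \<delta>: "\<delta> \<in> commutant" and v: "v \<in> V" "\<delta> v = 0" "v \<noteq> 0"
  shows "\<delta> = (\<lambda>v\<in>V. 0)"
proof -
  note add = additive_onD[OF commutantD(1)[OF \<delta>]]
  let ?K = "{v \<in> V. \<delta> v = 0}"
  have "?K = {0} \<or> ?K = V"
  proof (rule simple)
    show "a u \<in> ?K" if "a \<in> A" "u \<in> ?K" for a u
      using that commutantD(2)[OF \<delta>] additive_onD[OF A_additive] by auto
  qed (use v add diff_V in auto)
  then have "?K = V" using v by auto
  then show ?thesis using commutantD(1)[OF \<delta>]
    by (intro extensionalityI[of _ V]) (auto simp: additive_on_def PiE_def)
qed

lemma commutant_diff: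
  assumes "\<delta> \<in> commutant" "\<epsilon> \<in> commutant"
  shows "(\<lambda>v\<in>V. \<delta> v - \<epsilon> v) \<in> commutant"
  using assms additive_onD[OF commutantD(1)] additive_onD[OF A_additive]
  by (auto simp: commutant_def additive_on_def diff_V add_V zero_V simp del: PiE_iff intro!: restrict_PiE_iff[THEN iffD2])

lemma ann_closure_mono: "T \<subseteq> T' \<Longrightarrow> ann_closure T \<subseteq> ann_closure T'"
  by (auto simp: ann_closure_def ann_def)

lemma ann_closure_commutant:
  assumes "\<delta> \<in> commutant" "v \<in> ann_closure T"
  shows "\<delta> v \<in> ann_closure T"
  using assms commutantD(2)[OF assms(1)] additive_onD[OF commutantD(1)[OF assms(1)]]
  by (auto simp: ann_closure_def ann_def) (metis)

lemma ann_closure_diff_add: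
  assumes "u \<in> ann_closure T" "v \<in> ann_closure T"
  shows "u - v \<in> ann_closure T" "u + v \<in> ann_closure T"
proof -
  have "a (u - v) = 0 \<and> a (u + v) = 0" if a: "a \<in> ann T" for a
  proof -
    have "a \<in> A" using a by (simp add: ann_def)
    then show ?thesis
      using additive_onD(2,3)[OF A_additive, of a u v] assms a by (auto simp: ann_closure_def)
  qed
  then show "u - v \<in> ann_closure T" "u + v \<in> ann_closure T"
    using assms diff_V add_V by (auto simp: ann_closure_def)
qed

text \<open>
  The image is a submodule of \<open>V\<close>; it is nonzero since some annihilator of \<open>T\<close> moves \<open>v\<close>.
\<close>

lemma ann_image_eq:
  assumes v: "v \<in> V" "v \<notin> ann_closure T" and T: "T \<subseteq> V"
  shows "(\<lambda>a. a v) ` ann T = V"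
proof -
  let ?W = "(\<lambda>a. a v) ` ann T"
  have diff: "(\<lambda>v\<in>V. a v - b v) \<in> ann T" if "a \<in> ann T" "b \<in> ann T" for a b
    using that T A_diff by (auto simp: ann_def subset_iff)
  have mult: "(\<lambda>v\<in>V. a (b v)) \<in> ann T" if "a \<in> A" "b \<in> ann T" for a b
    using that T A_mult additive_onD(4)[OF A_additive] by (auto simp: ann_def subset_iff)
  have "?W = {0} \<or> ?W = V"
  proof (rule simple)
    show "?W \<subseteq> V" using v additive_onD(1)[OF A_additive] by (auto simp: ann_def)
    show "?W \<noteq> {}" using v by (auto simp: ann_closure_def)
    show "x - y \<in> ?W" if "x \<in> ?W" "y \<in> ?W" for x y
    proof -
      obtain a b where "a \<in> ann T" "b \<in> ann T" "x = a v" "y = b v" using \<open>x \<in> ?W\<close> \<open>y \<in> ?W\<close> by blast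
      then show ?thesis
        using diff[of a b] v(1) by (intro image_eqI[of _ _ "\<lambda>v\<in>V. a v - b v"]) auto
    qed
    show "a x \<in> ?W" if "a \<in> A" "x \<in> ?W" for a x
    proof -
      obtain b where "b \<in> ann T" "x = b v" using \<open>x \<in> ?W\<close> by blast
      then show ?thesis
        using mult[of a b] v(1) \<open>a \<in> A\<close> by (intro image_eqI[of _ _ "\<lambda>v\<in>V. a (b v)"]) auto
    qed
  qed
  then show ?thesis using v by (auto simp: ann_closure_def)
qed

text \<open>
  The induction step of the density theorem: adjoining a vector outside the closure adds one free
  coordinate over the commutant. For \<open>w\<close> in the larger closure, \<open>a v \<mapsto> a w\<close> for \<open>a\<close> annihilating \<open>T\<close> is a
  well-defined endomorphism \<open>\<delta>\<close> of \<open>V\<close>, and \<open>w - \<delta> v\<close> is killed by all these \<open>a\<close>.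
\<close>

lemma ann_closure_insert:
  assumes v: "v \<in> V" "v \<notin> ann_closure T" and T: "T \<subseteq> V"
  shows "bij_betw (\<lambda>(u, \<delta>). u + \<delta> v) (ann_closure T \<times> commutant) (ann_closure (insert v T))"
  unfolding bij_betw_def
proof
  show "inj_on (\<lambda>(u, \<delta>). u + \<delta> v) (ann_closure T \<times> commutant)"
  proof (rule inj_onI, clarify)
    fix u \<delta> u' \<epsilon>
    assume *: "u \<in> ann_closure T" "\<delta> \<in> commutant" "u' \<in> ann_closure T" "\<epsilon> \<in> commutant"
      "u + \<delta> v = u' + \<epsilon> v"
    define \<eta> where "\<eta> = (\<lambda>v\<in>V. \<delta> v - \<epsilon> v)"
    have \<eta>: "\<eta> \<in> commutant" using * unfolding \<eta>_def by (intro commutant_diff)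
    have "\<eta> v = u' - u" using *(5) v by (simp add: \<eta>_def algebra_simps)
    then have "\<eta> v \<in> ann_closure T" using * ann_closure_diff_add by simp
    have \<eta>_0: "\<eta> = (\<lambda>v\<in>V. 0)"
    proof -
      obtain a where a: "a \<in> ann T" "a v \<noteq> 0" using v by (auto simp: ann_closure_def)
      have aA: "a \<in> A" using a by (simp add: ann_def)
      have "\<eta> (a v) = a (\<eta> v)" using commutantD(2)[OF \<eta> aA] v by simp
      also have "\<dots> = 0" using \<open>\<eta> v \<in> ann_closure T\<close> a by (simp add: ann_closure_def)
      finally show ?thesis
        using schur[OF \<eta>] a(2) additive_onD(1)[OF A_additive[OF aA]] v by blast
    qed
    then have "\<delta> x = \<epsilon> x" if "x \<in> V" for x
    proof -
      have "\<eta> x = 0" using that \<eta>_0 by simp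
      then show ?thesis using that by (simp add: \<eta>_def)
    qed
    then have "\<delta> = \<epsilon>" using * by (intro additive_on_ext[OF commutantD(1) commutantD(1)]) auto
    then show "u = u' \<and> \<delta> = \<epsilon>" using * by simp
  qed
  show "(\<lambda>(u, \<delta>). u + \<delta> v) ` (ann_closure T \<times> commutant) = ann_closure (insert v T)"
  proof (intro equalityI subsetI)
    fix x assume "x \<in> (\<lambda>(u, \<delta>). u + \<delta> v) ` (ann_closure T \<times> commutant)"
    then obtain u \<delta> where x: "u \<in> ann_closure T" "\<delta> \<in> commutant" "x = u + \<delta> v" by auto
    have "v \<in> ann_closure (insert v T)" using v by (simp add: ann_closure_def ann_def)
    moreover have "u \<in> ann_closure (insert v T)" using x ann_closure_mono[of T "insert v T"] by blast
    ultimately show "x \<in> ann_closure (insert v T)" using x ann_closure_diff_add ann_closure_commutant by simp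
  next
    fix w assume w: "w \<in> ann_closure (insert v T)"
    have wV: "w \<in> V" using w by (simp add: ann_closure_def)
    have diff: "(\<lambda>v\<in>V. a v - b v) \<in> ann T" if "a \<in> ann T" "b \<in> ann T" for a b
      using that T A_diff by (auto simp: ann_def subset_iff)
    have well: "a w = b w" if "a \<in> ann T" "b \<in> ann T" "a v = b v" for a b
    proof -
      have "(\<lambda>v\<in>V. a v - b v) \<in> ann (insert v T)"
        using diff[OF that(1,2)] that(3) v by (simp add: ann_def)
      then have "(\<lambda>v\<in>V. a v - b v) w = 0" using w unfolding ann_closure_def by blast
      then show ?thesis using wV by simp
    qed
    have im: "(\<lambda>a. a v) ` ann T = V" by (rule ann_image_eq[OF v T])
    have "\<forall>x. \<exists>a. x \<in> V \<longrightarrow> a \<in> ann T \<and> a v = x" using im by blast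
    then obtain pick where pick: "pick x \<in> ann T" "pick x v = x" if "x \<in> V" for x by metis
    define \<delta> where "\<delta> = (\<lambda>x\<in>V. pick x w)"
    have \<delta>: "\<delta> (a v) = a w" if "a \<in> ann T" for a
    proof -
      have "a v \<in> V" using that im by blast
      then show ?thesis unfolding \<delta>_def using well[of "pick (a v)" a] pick that by simp
    qed
    have "\<delta> \<in> commutant"
      unfolding commutant_def additive_on_def
    proof (intro CollectI conjI ballI)
      show "\<delta> \<in> V \<rightarrow>\<^sub>E V"
        unfolding \<delta>_def using pick wV additive_onD(1)[OF A_additive] by (auto simp: ann_def)
    next
      fix x y assume xy: "x \<in> V" "y \<in> V"
      let ?a = "\<lambda>v\<in>V. pick x v + pick y v"
      have "?a \<in> ann T"
        using pick xy A_add T by (auto simp: ann_def subset_iff)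
      moreover have "?a v = x + y" using v pick xy by simp
      ultimately have "\<delta> (x + y) = ?a w" using \<delta> by metis
      then show "\<delta> (x + y) = \<delta> x + \<delta> y" using xy wV by (simp add: \<delta>_def)
    next
      fix a x assume ax: "a \<in> A" "x \<in> V"
      let ?b = "\<lambda>v\<in>V. a (pick x v)"
      have "?b \<in> ann T"
        using pick[OF ax(2)] ax A_mult T additive_onD(4)[OF A_additive] by (auto simp: ann_def subset_iff)
      moreover have "?b v = a x" using v pick ax by simp
      ultimately have "\<delta> (a x) = ?b w" using \<delta> by metis
      then show "\<delta> (a x) = a (\<delta> x)" using ax wV by (simp add: \<delta>_def)
    qed
    have "a (w - \<delta> v) = 0" if a: "a \<in> ann T" for a
    proof -
      have aA: "a \<in> A" using a by (simp add: ann_def)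
      note add = additive_onD[OF A_additive[OF aA]]
      have "a (w - \<delta> v) = a w - a (\<delta> v)"
        using add wV v additive_onD(1)[OF commutantD(1)[OF \<open>\<delta> \<in> commutant\<close>]] by blast
      also have "a (\<delta> v) = \<delta> (a v)" using commutantD(2)[OF \<open>\<delta> \<in> commutant\<close> aA v(1)] ..
      finally show ?thesis using \<delta>[OF a] by simp
    qed
    then have "w - \<delta> v \<in> ann_closure T"
      using wV v diff_V additive_onD(1)[OF commutantD(1)[OF \<open>\<delta> \<in> commutant\<close>]]
      by (simp add: ann_closure_def)
    then show "w \<in> (\<lambda>(u, \<delta>). u + \<delta> v) ` (ann_closure T \<times> commutant)"
      using \<open>\<delta> \<in> commutant\<close> by (intro image_eqI[of _ _ "(w - \<delta> v, \<delta>)"]) auto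
  qed
qed

text \<open>
  Evaluation at \<open>v\<close> maps the annihilator of \<open>T\<close> onto \<open>V\<close>, and its kernel is the smaller annihilator.
\<close>

lemma card_ann_insert:
  assumes v: "v \<in> V" "v \<notin> ann_closure T" and T: "T \<subseteq> V"
  shows "card (ann T) = card V * card (ann (insert v T))"
proof -
  have fin: "finite (ann T)" using A_finite by (simp add: ann_def)
  have "card (ann T) = card ((\<lambda>a. a v) ` ann T) * card (ann (insert v T))"
  proof (rule card_eq_card_image_times_fibre[OF fin])
    fix y assume "y \<in> (\<lambda>a. a v) ` ann T"
    then obtain a where a: "a \<in> ann T" "a v = y" by blast
    have aA: "a \<in> A" "b \<in> ann T \<Longrightarrow> b \<in> A" for b using a by (auto simp: ann_def)
    have "bij_betw (\<lambda>b. \<lambda>v\<in>V. a v + b v) (ann (insert v T)) {x \<in> ann T. x v = y}"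
    proof (rule bij_betwI[where g = "\<lambda>b. \<lambda>v\<in>V. b v - a v"])
      show "(\<lambda>b. \<lambda>v\<in>V. a v + b v) \<in> ann (insert v T) \<rightarrow> {x \<in> ann T. x v = y}"
        using a v T A_add by (auto simp: ann_def subset_iff)
      show "(\<lambda>b. \<lambda>v\<in>V. b v - a v) \<in> {x \<in> ann T. x v = y} \<rightarrow> ann (insert v T)"
        using a v T A_diff by (auto simp: ann_def subset_iff)
      show "(\<lambda>u\<in>V. (\<lambda>u\<in>V. a u + x u) u - a u) = x" if "x \<in> ann (insert v T)" for x
        using that A_additive[of x]
        by (intro extensionalityI[of _ V]) (auto simp: ann_def additive_on_def PiE_def)
      show "(\<lambda>u\<in>V. a u + (\<lambda>u\<in>V. x u - a u) u) = x" if "x \<in> {x \<in> ann T. x v = y}" for x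
        using that A_additive[of x]
        by (intro extensionalityI[of _ V]) (auto simp: ann_def additive_on_def PiE_def)
    qed
    then show "card {x \<in> ann T. x v = y} = card (ann (insert v T))"
      by (rule bij_betw_same_card[symmetric])
  qed
  then show ?thesis by (simp add: ann_image_eq[OF v T])
qed

lemma ann_closure_insert_trivial:
  assumes "v \<in> ann_closure T"
  shows "ann (insert v T) = ann T" "ann_closure (insert v T) = ann_closure T"
proof -
  show "ann (insert v T) = ann T" using assms by (auto simp: ann_def ann_closure_def)
  then show "ann_closure (insert v T) = ann_closure T" by (simp add: ann_closure_def)
qed

lemma ann_closure_empty: "ann_closure {} = {0}"
proof -
  have "v = 0" if "v \<in> ann_closure {}" for v
    using that A_one by (force simp: ann_closure_def ann_def)
  then show ?thesis using zero_V additive_onD(4)[OF A_additive] by (auto simp: ann_closure_def ann_def)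
qed

text \<open>
  Both sides of the duality grow in step: each vector that enlarges the closure of \<open>T\<close> divides the
  annihilator by \<open>|V|\<close> and multiplies the closure by the size of the commutant.
\<close>

lemma density:
  assumes "finite T" "T \<subseteq> V"
  shows "\<exists>k. card A = card V ^ k * card (ann T) \<and> card (ann_closure T) = card commutant ^ k"
  using assms
proof (induction T)
  case empty
  show ?case by (intro exI[of _ 0]) (simp add: ann_closure_empty ann_def)
next
  case (insert v T)
  then obtain k where k: "card A = card V ^ k * card (ann T)" "card (ann_closure T) = card commutant ^ k"
    by auto
  show ?case
  proof (cases "v \<in> ann_closure T")
    case True
    then show ?thesis using k ann_closure_insert_trivial by auto
  next
    case False
    have v: "v \<in> V" "T \<subseteq> V" using insert.prems by auto
    show ?thesis
      using k card_ann_insert[OF v(1) False v(2)] bij_betw_same_card[OF ann_closure_insert[OF v(1) False v(2)]]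
      by (intro exI[of _ "Suc k"]) (simp add: card_cartesian_product mult.commute)
  qed
qed

text \<open>
  An element of \<open>A\<close> that agrees with \<open>g\<close> so far can be corrected at one further vector \<open>v\<close> by an
  annihilator of \<open>T\<close>; agreement then spreads to the new closure as both maps commute with the commutant.
\<close>

lemma density_interpolation:
  assumes g: "additive_on V g" "\<And>\<delta> v. \<delta> \<in> commutant \<Longrightarrow> v \<in> V \<Longrightarrow> g (\<delta> v) = \<delta> (g v)"
    and "finite T" "T \<subseteq> V"
  shows "\<exists>a\<in>A. \<forall>v\<in>ann_closure T. a v = g v"
  using assms(3,4)
proof (induction T)
  case empty
  show ?case using A_one ann_closure_empty zero_V additive_onD(4)[OF g(1)] by (intro bexI[of _ "\<lambda>v\<in>V. v"]) auto
next
  case (insert v T)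
  then obtain a where a: "a \<in> A" "\<And>u. u \<in> ann_closure T \<Longrightarrow> a u = g u" by auto
  show ?case
  proof (cases "v \<in> ann_closure T")
    case True
    then show ?thesis using a ann_closure_insert_trivial by auto
  next
    case False
    have v: "v \<in> V" "T \<subseteq> V" using insert.prems by auto
    have "g v - a v \<in> V"
      using v diff_V additive_onD(1)[OF g(1)] additive_onD(1)[OF A_additive[OF a(1)]] by blast
    then obtain l where l: "l \<in> ann T" "l v = g v - a v"
      using ann_image_eq[OF v(1) False v(2)] by (metis imageE)
    let ?b = "\<lambda>v\<in>V. a v + l v"
    have lA: "l \<in> A" using l by (simp add: ann_def)
    have b: "?b \<in> A" by (rule A_add[OF a(1) lA])
    have "?b w = g w" if wc: "w \<in> ann_closure (insert v T)" for w
    proof -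
      obtain u \<delta> where w: "w = u + \<delta> v" "u \<in> ann_closure T" "\<delta> \<in> commutant"
        using wc bij_betw_imp_surj_on[OF ann_closure_insert[OF v(1) False v(2)], symmetric] by auto
      have V: "u \<in> V" "\<delta> v \<in> V"
        using w v additive_onD(1)[OF commutantD(1)] by (auto simp: ann_closure_def)
      have "?b w = ?b u + ?b (\<delta> v)"
        unfolding w(1) using V additive_onD(2)[OF A_additive[OF b]] by blast
      also have "?b u = g u" using V a(2)[OF w(2)] w(2) l by (auto simp: ann_closure_def)
      also have "?b (\<delta> v) = \<delta> (?b v)" using commutantD(2)[OF w(3) b v(1)] ..
      also have "?b v = g v" using v l by simp
      also have "\<delta> (g v) = g (\<delta> v)" using g(2) w v by simp
      also have "g u + g (\<delta> v) = g w" unfolding w(1) using V additive_onD(2)[OF g(1)] by simp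
      finally show ?thesis .
    qed
    then show ?thesis using b by blast
  qed
qed

lemma ann_closure_V: "ann_closure V = V" "card (ann V) = 1"
proof -
  show "ann_closure V = V" by (auto simp: ann_closure_def ann_def)
  have "(\<lambda>v\<in>V. 0) \<in> A" using A_diff[OF A_one A_one] by (simp cong: restrict_cong)
  then have "ann V = {\<lambda>v\<in>V. 0}"
    using A_additive by (auto simp: ann_def additive_on_def PiE_def intro!: extensionalityI[of _ V])
  then show "card (ann V) = 1" by simp
qed

theorem card_simple_module:
  "\<exists>k. card A = card V ^ k \<and> card V = card commutant ^ k"
  using density[OF finite_V subset_refl] ann_closure_V by simp

theorem double_commutant:
  assumes "additive_on V g" "\<And>\<delta> v. \<delta> \<in> commutant \<Longrightarrow> v \<in> V \<Longrightarrow> g (\<delta> v) = \<delta> (g v)"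
  shows "g \<in> A"
proof -
  obtain a where "a \<in> A" "\<And>v. v \<in> V \<Longrightarrow> a v = g v"
    using density_interpolation[OF assms finite_V subset_refl] ann_closure_V by auto
  then show ?thesis using additive_on_ext[OF A_additive assms(1)] by metis
qed

end

section \<open>Skew polynomials and residues\<close>

text \<open>
  The set of admissible coefficients may depend on the position: this covers residues modulo a
  polynomial as well as polynomials in a power of the variable.
\<close>

lemma card_polys_with_coeffs_in:
  fixes S :: "nat \<Rightarrow> 'a::{zero, finite} set"
  assumes "\<And>i. 0 \<in> S i"
  shows "card {p :: 'a poly. (\<forall>i. coeff p i \<in> S i) \<and> (\<forall>i\<ge>N. coeff p i = 0)} = (\<Prod>i<N. card (S i))"
    (is "card ?P = _")
proof -
  have "bij_betw (\<lambda>p. \<lambda>i\<in>{..<N}. coeff p i) ?P (\<Pi>\<^sub>E i\<in>{..<N}. S i)"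
  proof (rule bij_betwI)
    let ?inv = "\<lambda>g. Abs_poly (\<lambda>i. if i < N then g i else 0)"
    have coeff_inv: "coeff (?inv g) i = (if i < N then g i else 0)" for g i
      by (subst coeff_Abs_poly[of N]) auto
    show "?inv \<in> (\<Pi>\<^sub>E i\<in>{..<N}. S i) \<rightarrow> ?P"
      using assms by (auto simp: coeff_inv)
    show "?inv (\<lambda>i\<in>{..<N}. coeff p i) = p" if "p \<in> ?P" for p
      using that by (intro poly_eqI) (auto simp: coeff_inv)
    show "(\<lambda>i\<in>{..<N}. coeff (?inv g) i) = g" if "g \<in> (\<Pi>\<^sub>E i\<in>{..<N}. S i)" for g
      using that by (intro extensionalityI[of _ "{..<N}"]) (auto simp: coeff_inv PiE_def)
  qed auto
  then have "card ?P = card (\<Pi>\<^sub>E i\<in>{..<N}. S i)" by (rule bij_betw_same_card)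
  then show ?thesis by (simp add: card_PiE)
qed

lemma coeff_bound_imp_degree_less:
  assumes "\<forall>i\<ge>N. coeff p i = 0" "p \<noteq> 0"
  shows "degree p < N"
  using assms leading_coeff_0_iff not_less by blast

lemma deg_less_iff_coeff:
  assumes "f \<noteq> 0"
  shows "deg_less a f \<longleftrightarrow> (\<forall>i\<ge>degree f. coeff a i = 0)"
  using assms coeff_bound_imp_degree_less[of "degree f" a]
  by (cases "a = 0") (auto simp: deg_less_def coeff_eq_0)

lemma coeff_skew_mult:
  assumes "field_automorphism \<sigma>"
  shows "coeff (skew_mult \<sigma> a b) m = (\<Sum>i\<le>m. coeff a i * (\<sigma> ^^ i) (coeff b (m - i)))"
proof -
  define M where "M = max (degree a) m"
  define K where "K = max (degree b) m"
  have "coeff (skew_mult \<sigma> a b) m =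
      (\<Sum>i\<le>M. \<Sum>j\<le>K. if i + j = m then coeff a i * (\<sigma> ^^ i) (coeff b j) else 0)"
    by (subst skew_mult_bounds[OF assms, of _ M _ K]) (simp_all add: M_def K_def coeff_sum)
  also have "\<dots> = (\<Sum>i\<le>M. if i \<le> m then coeff a i * (\<sigma> ^^ i) (coeff b (m - i)) else 0)"
  proof (rule sum.cong[OF refl])
    fix i
    have "(\<Sum>j\<le>K. if i + j = m then coeff a i * (\<sigma> ^^ i) (coeff b j) else 0) =
        (\<Sum>j\<le>K. if j = m - i then (if i \<le> m then coeff a i * (\<sigma> ^^ i) (coeff b (m - i)) else 0) else 0)"
      by (intro sum.cong) auto
    then show "(\<Sum>j\<le>K. if i + j = m then coeff a i * (\<sigma> ^^ i) (coeff b j) else 0) =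
        (if i \<le> m then coeff a i * (\<sigma> ^^ i) (coeff b (m - i)) else 0)"
      by (simp add: K_def le_max_iff_disj)
  qed
  also have "\<dots> = (\<Sum>i\<le>m. coeff a i * (\<sigma> ^^ i) (coeff b (m - i)))"
    by (rule sum.mono_neutral_cong_right) (auto simp: M_def)
  finally show ?thesis .
qed

locale skew_poly =
  fixes \<sigma> :: "'a::{field, finite} \<Rightarrow> 'a"
  assumes aut: "field_automorphism \<sigma>"
begin

abbreviation mul :: "'a poly \<Rightarrow> 'a poly \<Rightarrow> 'a poly" (infixl "\<star>" 70) where
  "a \<star> b \<equiv> skew_mult \<sigma> a b"

abbreviation t :: "'a poly" where
  "t \<equiv> monom 1 (Suc 0)"

lemmas skew_0 [simp] = skew_mult_0[OF aut]
lemmas skew_1 [simp] = skew_mult_1[OF aut]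
lemmas assoc = skew_mult_assoc[OF aut]
lemmas distrib = skew_mult_add_left[OF aut] skew_mult_add_right[OF aut]
lemmas aut_pow [simp] = funpow_aut_0[OF aut] funpow_aut_1[OF aut] funpow_aut_eq_0_iff[OF aut]
lemmas coeff_mul = coeff_skew_mult[OF aut]
lemmas degree_mul = degree_skew_mult[OF aut]

lemma minus_distrib: "(a - b) \<star> c = a \<star> c - b \<star> c" "c \<star> (a - b) = c \<star> a - c \<star> b"
  using distrib(1)[of "a - b" b c] distrib(2)[of c "a - b" b] by (simp_all add: algebra_simps)

lemma coeff_const_mul: "coeff ([:c:] \<star> a) i = c * coeff a i"
proof -
  have "coeff ([:c:] \<star> a) i = (\<Sum>j\<le>i. if j = 0 then c * coeff a i else 0)"
    unfolding coeff_mul by (intro sum.cong) (auto simp: coeff_pCons split: nat.split)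
  then show ?thesis by simp
qed

lemma coeff_mul_const: "coeff (a \<star> [:c:]) i = coeff a i * (\<sigma> ^^ i) c"
proof -
  have "coeff (a \<star> [:c:]) i = (\<Sum>j\<le>i. if j = i then coeff a i * (\<sigma> ^^ i) c else 0)"
    unfolding coeff_mul by (intro sum.cong) (auto simp: coeff_pCons split: nat.split)
  then show ?thesis by simp
qed

lemma const_mul_const: "[:a:] \<star> [:b:] = [:a * b:]"
  by (intro poly_eqI) (auto simp: coeff_const_mul coeff_pCons split: nat.split)

lemma coeff_t_mul: "coeff (t \<star> a) i = (case i of 0 \<Rightarrow> 0 | Suc j \<Rightarrow> \<sigma> (coeff a j))"
proof -
  have "coeff (t \<star> a) i = (\<Sum>j\<le>i. if j = 1 then \<sigma> (coeff a (i - 1)) else 0)"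
    unfolding coeff_mul by (intro sum.cong) auto
  then show ?thesis by (auto split: nat.split)
qed

lemma coeff_mul_t: "coeff (a \<star> t) i = (case i of 0 \<Rightarrow> 0 | Suc j \<Rightarrow> coeff a j)"
proof -
  have "coeff (a \<star> t) i = (\<Sum>j\<le>i. if i = Suc j then coeff a (i - 1) else 0)"
    unfolding coeff_mul by (intro sum.cong) auto
  also have "\<dots> = (case i of 0 \<Rightarrow> 0 | Suc j \<Rightarrow> coeff a j)"
    by (cases i) auto
  finally show ?thesis .
qed

lemma coeff_mul_0: "coeff (a \<star> b) 0 = coeff a 0 * coeff b 0"
  by (simp add: coeff_mul)

lemma right_factor_t:
  assumes "coeff a 0 = 0"
  shows "\<exists>b. a = b \<star> t \<and> (\<forall>i. coeff b i = coeff a (Suc i))"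
proof -
  define b where "b = Abs_poly (\<lambda>i. coeff a (Suc i))"
  have cb: "coeff b i = coeff a (Suc i)" for i
    unfolding b_def by (subst coeff_Abs_poly[of "degree a"]) (auto simp: coeff_eq_0)
  moreover have "a = b \<star> t"
    by (rule poly_eqI) (use assms in \<open>auto simp: coeff_mul_t cb split: nat.split\<close>)
  ultimately show ?thesis by blast
qed

text \<open>
  Right division with remainder makes a nonzero element of least degree a generator.
\<close>

lemma left_ideal_principal:
  assumes J: "\<And>x y. x \<in> J \<Longrightarrow> y \<in> J \<Longrightarrow> x - y \<in> J" "\<And>r x. x \<in> J \<Longrightarrow> r \<star> x \<in> J"
    and nz: "x \<in> J" "x \<noteq> 0"
  shows "\<exists>g\<in>J. lead_coeff g = 1 \<and> (\<forall>y\<in>J. \<exists>u. y = u \<star> g)"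
proof -
  obtain g' where g': "g' \<in> J" "g' \<noteq> 0"
    and least: "\<And>y. y \<in> J \<Longrightarrow> y \<noteq> 0 \<Longrightarrow> degree g' \<le> degree y"
    using ex_has_least_nat[of "\<lambda>x. x \<in> J \<and> x \<noteq> 0" x degree] nz by blast
  define g where "g = [:inverse (lead_coeff g'):] \<star> g'"
  have nzc: "[:inverse (lead_coeff g'):] \<noteq> 0" using g' by simp
  have deg: "degree g = degree g'" "g \<noteq> 0"
    using degree_mul[OF nzc g'(2)] by (simp_all add: g_def)
  have "lead_coeff g = 1"
    unfolding deg(1) using g' by (simp add: g_def coeff_const_mul)
  moreover have gJ: "g \<in> J" using J(2)[OF g'(1)] by (simp add: g_def)
  moreover have "\<exists>u. y = u \<star> g" if y: "y \<in> J" for y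
  proof -
    obtain u v where uv: "y = u \<star> g + v" "deg_less v g"
      using skew_division_exists[OF aut deg(2)] by blast
    have "v = y - u \<star> g" using uv by simp
    then have "v \<in> J" using J y gJ by simp
    then have "v = 0" using least[of v] uv(2) deg by (metis deg_less_def not_le)
    then show ?thesis using uv by auto
  qed
  ultimately show ?thesis by blast
qed

end

locale skew_modulus = skew_poly +
  fixes f :: "'a poly"
  assumes degree_pos: "degree f > 0"
begin

abbreviation red :: "'a poly \<Rightarrow> 'a poly" where
  "red a \<equiv> skew_mod \<sigma> a f"

definition V :: "'a poly set" where
  "V = {v. deg_less v f}"

text \<open>
  The idealizer of the left ideal \<open>R f\<close>, modulo \<open>R f\<close>.
\<close>

definition eigenring :: "'a poly set" where
  "eigenring = {z \<in> V. red (f \<star> z) = 0}"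

lemma f_nonzero: "f \<noteq> 0" using degree_pos by auto

lemma V_iff: "v \<in> V \<longleftrightarrow> (\<forall>i\<ge>degree f. coeff v i = 0)"
  by (simp add: V_def deg_less_iff_coeff[OF f_nonzero])

lemma V_degree: "v \<in> V \<Longrightarrow> degree v < degree f"
  using degree_pos by (auto simp: V_def deg_less_def)

lemma V_I: "degree v < degree f \<Longrightarrow> v \<in> V"
  using f_nonzero by (auto simp: V_def deg_less_def)

lemma V_closed: "0 \<in> V" "1 \<in> V" "[:c:] \<in> V" "u \<in> V \<Longrightarrow> v \<in> V \<Longrightarrow> u - v \<in> V"
    "u \<in> V \<Longrightarrow> v \<in> V \<Longrightarrow> u + v \<in> V"
  using degree_pos by (auto simp: V_iff coeff_1 coeff_pCons split: nat.split)

lemma red_eqI: "a = u \<star> f + v \<Longrightarrow> v \<in> V \<Longrightarrow> red a = v"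
  using skew_mod_eqI[OF aut] by (simp add: V_def)

lemma red_decomp:
  obtains u where "a = u \<star> f + red a" "red a \<in> V"
proof -
  obtain u v where "a = u \<star> f + v" "v \<in> V"
    using skew_division_exists[OF aut f_nonzero, of a] by (auto simp: V_def)
  then show thesis using that red_eqI by metis
qed

lemma red_in_V [simp]: "red a \<in> V" by (metis red_decomp)

lemma red_id: "v \<in> V \<Longrightarrow> red v = v"
  using red_eqI[of v 0 v] by simp

lemma red_0 [simp]: "red 0 = 0" by (rule red_id) (rule V_closed)

lemma red_add: "red (a + b) = red a + red b"
proof -
  obtain u where u: "a = u \<star> f + red a" by (rule red_decomp)
  obtain u' where u': "b = u' \<star> f + red b" by (rule red_decomp)
  have "a + b = (u \<star> f + red a) + (u' \<star> f + red b)" by (rule arg_cong2[OF u u'])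
  also have "\<dots> = (u + u') \<star> f + (red a + red b)" by (simp add: distrib)
  finally have "a + b = (u + u') \<star> f + (red a + red b)" .
  then show ?thesis by (rule red_eqI) (simp add: V_closed)
qed

lemma red_diff: "red (a - b) = red a - red b"
  using red_add[of "a - b" b] by (simp add: algebra_simps)

lemma red_eq_0_iff: "red a = 0 \<longleftrightarrow> (\<exists>u. a = u \<star> f)"
  using red_eqI[of a _ 0] V_closed(1) by (metis add.right_neutral red_decomp)

lemma red_mul_f [simp]: "red (u \<star> f) = 0"
  using red_eq_0_iff by blast

text \<open>
  Since \<open>R f\<close> is a left ideal, a right factor may be reduced at any time. A left factor may be
  reduced before multiplying by \<open>z\<close> when \<open>f z \<in> R f\<close>, as in the next lemma. This asymmetry distinguishes the right nucleus from the others.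
\<close>

lemma red_mul_red: "red (a \<star> red b) = red (a \<star> b)"
proof -
  obtain u where u: "b = u \<star> f + red b" by (rule red_decomp)
  have "a \<star> b = (a \<star> u) \<star> f + a \<star> red b"
    by (subst u) (simp add: distrib assoc)
  then show ?thesis by (simp add: red_add)
qed

lemma red_red_mul:
  assumes "red (f \<star> z) = 0"
  shows "red (red a \<star> z) = red (a \<star> z)"
proof -
  obtain u where u: "a = u \<star> f + red a" by (rule red_decomp)
  have "red (a \<star> z) = red (u \<star> (f \<star> z)) + red (red a \<star> z)"
    by (subst u) (simp add: distrib assoc red_add)
  also have "red (u \<star> (f \<star> z)) = red (u \<star> red (f \<star> z))" by (simp only: red_mul_red)
  finally show ?thesis using assms by simp
qed

lemma card_V: "card V = CARD('a) ^ degree f"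
proof -
  have "V = {v. (\<forall>i. coeff v i \<in> UNIV) \<and> (\<forall>i\<ge>degree f. coeff v i = 0)}"
    by (auto simp: V_iff)
  then show ?thesis using card_polys_with_coeffs_in[of "\<lambda>_. UNIV :: 'a set" "degree f"] by simp
qed

lemma finite_V: "finite V"
  using card_V by (intro card_ge_0_finite) (simp add: card_gt_0_iff)

lemma eigenring_closed:
  "0 \<in> eigenring" "1 \<in> eigenring" "x \<in> eigenring \<Longrightarrow> y \<in> eigenring \<Longrightarrow> x + y \<in> eigenring"
  "x \<in> eigenring \<Longrightarrow> y \<in> eigenring \<Longrightarrow> x - y \<in> eigenring"
  "x \<in> eigenring \<Longrightarrow> y \<in> eigenring \<Longrightarrow> red (x \<star> y) \<in> eigenring"
proof -
  show "red (x \<star> y) \<in> eigenring" if "x \<in> eigenring" "y \<in> eigenring"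
  proof -
    have "red (f \<star> red (x \<star> y)) = red ((f \<star> x) \<star> y)" by (simp add: red_mul_red assoc)
    also have "\<dots> = red (red (f \<star> x) \<star> y)" using that(2) by (intro red_red_mul[symmetric]) (simp add: eigenring_def)
    also have "\<dots> = 0" using that by (simp add: eigenring_def)
    finally show ?thesis by (simp add: eigenring_def)
  qed
  have "red f = 0" using red_mul_f[of 1] by simp
  then show "1 \<in> eigenring" by (simp add: eigenring_def V_closed)
qed (simp_all add: eigenring_def V_closed distrib minus_distrib red_add red_diff)

definition act :: "'a poly \<Rightarrow> 'a poly \<Rightarrow> 'a poly" where
  "act r = (\<lambda>v\<in>V. red (r \<star> v))"

definition rmul :: "'a poly \<Rightarrow> 'a poly \<Rightarrow> 'a poly" where
  "rmul z = (\<lambda>v\<in>V. red (v \<star> z))"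

definition ann_ideal :: "'a poly set" where
  "ann_ideal = {r. \<forall>v\<in>V. red (r \<star> v) = 0}"

lemma act_eq_iff: "act r = act s \<longleftrightarrow> r - s \<in> ann_ideal"
proof -
  have "act r = act s \<longleftrightarrow> (\<forall>v\<in>V. red (r \<star> v) = red (s \<star> v))"
    by (metis (no_types, lifting) act_def restrict_apply' restrict_ext)
  then show ?thesis by (simp add: ann_ideal_def minus_distrib red_diff)
qed

lemma ann_ideal_closed:
  "x \<in> ann_ideal \<Longrightarrow> y \<in> ann_ideal \<Longrightarrow> x - y \<in> ann_ideal"
  "x \<in> ann_ideal \<Longrightarrow> r \<star> x \<in> ann_ideal"
  "x \<in> ann_ideal \<Longrightarrow> x \<star> r \<in> ann_ideal"
proof -
  show "r \<star> x \<in> ann_ideal" if "x \<in> ann_ideal"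
  proof -
    have "red (r \<star> x \<star> v) = red (r \<star> red (x \<star> v))" for v by (simp add: red_mul_red assoc)
    then show ?thesis using that by (simp add: ann_ideal_def)
  qed
  show "x \<star> r \<in> ann_ideal" if "x \<in> ann_ideal"
  proof -
    have "red (x \<star> r \<star> v) = red (x \<star> red (r \<star> v))" for v by (simp add: red_mul_red assoc)
    then show ?thesis using that by (simp add: ann_ideal_def)
  qed
qed (simp add: ann_ideal_def minus_distrib red_diff)

end

text \<open>
  The condition on the constant term excludes only the multiples of \<open>t\<close> among the irreducible \<open>f\<close>. It
  lets \<open>t\<close> act bijectively on the residues.
\<close>

locale skew_irreducible_modulus = skew_modulus +
  assumes irreducible: "skew_irreducible \<sigma> f" and coeff_0: "coeff f 0 \<noteq> 0"
begin

text \<open>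
  Simplicity: a nonzero residue \<open>w\<close> and \<open>f\<close> generate a left ideal \<open>R g\<close> with \<open>deg g < deg f\<close>. Then \<open>g\<close>
  divides the irreducible \<open>f\<close>, so \<open>g = 1\<close>, and every residue is a multiple of \<open>w\<close>.
\<close>

sublocale M: finite_simple_module V "range act"
proof
  show "finite V" by (rule finite_V)
  show "0 \<in> V" "u \<in> V \<Longrightarrow> v \<in> V \<Longrightarrow> u - v \<in> V" for u v by (rule V_closed)+
  show "additive_on V a" if "a \<in> range act" for a
    using that by (auto simp: additive_on_def act_def distrib red_add V_closed)
  have "act 1 = (\<lambda>v\<in>V. v)" by (simp add: act_def red_id cong: restrict_cong)
  then show "(\<lambda>v\<in>V. v) \<in> range act" by (metis rangeI)
  show "(\<lambda>v\<in>V. a v - b v) \<in> range act" if ab: "a \<in> range act" "b \<in> range act" for a b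
  proof -
    obtain r s where "a = act r" "b = act s" using ab by blast
    then have "(\<lambda>v\<in>V. a v - b v) = act (r - s)"
      by (simp add: act_def minus_distrib red_diff cong: restrict_cong)
    then show ?thesis by simp
  qed
  show "(\<lambda>v\<in>V. a (b v)) \<in> range act" if ab: "a \<in> range act" "b \<in> range act" for a b
  proof -
    obtain r s where "a = act r" "b = act s" using ab by blast
    then have "(\<lambda>v\<in>V. a (b v)) = act (r \<star> s)"
      by (simp add: act_def red_mul_red assoc cong: restrict_cong)
    then show ?thesis by simp
  qed
  show "W = {0} \<or> W = V"
    if W: "W \<subseteq> V" "W \<noteq> {}" "\<And>u v. u \<in> W \<Longrightarrow> v \<in> W \<Longrightarrow> u - v \<in> W"
      "\<And>a v. a \<in> range act \<Longrightarrow> v \<in> W \<Longrightarrow> a v \<in> W" for W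
  proof (cases "W \<subseteq> {0}")
    case True
    then show ?thesis using W(2) by blast
  next
    case False
    then obtain w where w: "w \<in> W" "w \<noteq> 0" by blast
    define J where "J = {x. \<exists>r s. x = r \<star> w + s \<star> f}"
    have J_I: "r \<star> w + s \<star> f \<in> J" for r s by (auto simp: J_def)
    have "x - y \<in> J" if xy: "x \<in> J" "y \<in> J" for x y
    proof -
      obtain r s where 1: "x = r \<star> w + s \<star> f" using xy by (auto simp: J_def)
      obtain r' s' where 2: "y = r' \<star> w + s' \<star> f" using xy by (auto simp: J_def)
      have "x - y = (r - r') \<star> w + (s - s') \<star> f" unfolding 1 2 minus_distrib by simp
      then show ?thesis using J_I by simp
    qed
    moreover have "r \<star> x \<in> J" if x: "x \<in> J" for r x
    proof -
      obtain p s where 1: "x = p \<star> w + s \<star> f" using x by (auto simp: J_def)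
      have "r \<star> x = (r \<star> p) \<star> w + (r \<star> s) \<star> f" unfolding 1 distrib assoc ..
      then show ?thesis using J_I by simp
    qed
    moreover have wJ: "w \<in> J" using J_I[of 1 0] by simp
    ultimately have "\<exists>g\<in>J. lead_coeff g = 1 \<and> (\<forall>y\<in>J. \<exists>u. y = u \<star> g)"
      using w(2) by (intro left_ideal_principal[of J w])
    then obtain g where g: "g \<in> J" "lead_coeff g = 1" "\<And>y. y \<in> J \<Longrightarrow> \<exists>u. y = u \<star> g"
      by blast
    have fJ: "f \<in> J" using J_I[of 0 1] by simp
    obtain a where a: "w = a \<star> g" using g(3)[OF wJ] by blast
    obtain b where b: "f = b \<star> g" using g(3)[OF fJ] by blast
    have nz: "a \<noteq> 0" "b \<noteq> 0" "g \<noteq> 0" using a b w(2) f_nonzero by auto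
    have "degree g < degree f"
      using degree_mul(1)[OF nz(1,3)] a V_degree[of w] W(1) w(1) by auto
    then have g_less: "deg_less g f" using f_nonzero by (simp add: deg_less_def)
    have "\<not> deg_less b f" using irreducible g_less b by (auto simp: skew_irreducible_def)
    then have "degree g = 0"
      using degree_mul(1)[OF nz(2,3)] b nz f_nonzero by (auto simp: deg_less_def)
    then have "g = 1" using g(2) by (auto elim!: degree_eq_zeroE simp: one_pCons)
    then obtain r s where rs: "1 = r \<star> w + s \<star> f" using g(1) by (auto simp: J_def)
    have "v \<in> W" if v: "v \<in> V" for v
    proof -
      have "v = v \<star> (r \<star> w + s \<star> f)" using rs by simp
      also have "\<dots> = (v \<star> r) \<star> w + (v \<star> s) \<star> f" by (simp add: distrib assoc)
      finally have "red v = red ((v \<star> r) \<star> w)" by (metis red_add red_mul_f add.right_neutral)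
      then have "v = act (v \<star> r) w" using v w(1) W(1) by (auto simp: act_def red_id)
      then show ?thesis using W(4)[of "act (v \<star> r)" w] w(1) by simp
    qed
    then show ?thesis using W(1) by blast
  qed
qed

text \<open>
  An endomorphism is determined by the image \<open>z\<close> of 1 and is right multiplication by it; that \<open>f\<close> acts
  as zero says \<open>f z \<in> R f\<close>.
\<close>

lemma eigenring_commutant: "bij_betw rmul eigenring M.commutant"
  unfolding bij_betw_def
proof
  show "inj_on rmul eigenring"
  proof (rule inj_onI)
    fix z w assume "z \<in> eigenring" "w \<in> eigenring" "rmul z = rmul w"
    then have "rmul z 1 = rmul w 1" by simp
    then show "z = w" using \<open>z \<in> eigenring\<close> \<open>w \<in> eigenring\<close>
      by (simp add: rmul_def V_closed eigenring_def red_id)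
  qed
  show "rmul ` eigenring = M.commutant"
  proof (intro equalityI subsetI)
    fix \<delta> assume "\<delta> \<in> rmul ` eigenring"
    then obtain z where z: "z \<in> eigenring" "\<delta> = rmul z" by blast
    have "red (red (r \<star> v) \<star> z) = red (r \<star> red (v \<star> z))" for r v
      using z by (simp add: red_red_mul red_mul_red assoc eigenring_def)
    then show "\<delta> \<in> M.commutant"
      unfolding M.commutant_def z
      by (auto simp: additive_on_def rmul_def act_def distrib red_add V_closed)
  next
    fix \<delta> assume \<delta>: "\<delta> \<in> M.commutant"
    note \<delta>D = M.commutantD[OF \<delta>]
    define z where "z = \<delta> 1"
    have zV: "z \<in> V" using M.additive_onD(1)[OF \<delta>D(1)] V_closed by (simp add: z_def)
    have eq: "\<delta> (red r) = red (r \<star> z)" for r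
      using \<delta>D(2)[of "act r" 1] zV by (simp add: act_def V_closed flip: z_def)
    have "\<delta> v = rmul z v" if "v \<in> V" for v
      using eq[of v] that by (simp add: red_id rmul_def)
    moreover have "rmul z \<in> V \<rightarrow>\<^sub>E V" by (auto simp: rmul_def)
    ultimately have "\<delta> = rmul z"
      using \<delta>D(1) by (intro extensionalityI[of _ V]) (auto simp: additive_on_def PiE_def)
    moreover have "red (f \<star> z) = 0"
      using eq[of f] red_mul_f[of 1] M.additive_onD(4)[OF \<delta>D(1)] by simp
    then have "z \<in> eigenring" using zV by (simp add: eigenring_def)
    ultimately show "\<delta> \<in> rmul ` eigenring" by blast
  qed
qed

lemma card_commutant: "card M.commutant = card eigenring"
  using bij_betw_same_card[OF eigenring_commutant] ..

end

section \<open>The annihilator of the residues\<close>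

context skew_irreducible_modulus
begin

text \<open>
  The infinite ring \<open>R\<close> acts through a finite ring of maps.
\<close>

lemma ann_ideal_nonzero: "\<exists>r\<in>ann_ideal. r \<noteq> 0"
proof (rule ccontr)
  assume *: "\<not> (\<exists>r\<in>ann_ideal. r \<noteq> 0)"
  have "inj act"
    using * act_eq_iff by (metis eq_iff_diff_eq_0 injI)
  then have "finite (UNIV :: 'a poly set)" using M.A_finite finite_imageD by blast
  moreover have "inj (\<lambda>i. monom (1::'a) i)"
    by (rule injI) (metis degree_monom_eq one_neq_zero)
  ultimately have "finite (UNIV :: nat set)"
    using finite_imageD[of "\<lambda>i. monom (1::'a) i" UNIV] finite_subset[OF subset_UNIV] by blast
  then show False by simp
qed

text \<open>
  The monic generator of the annihilator: its degree measures the size of the ring of maps, and its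
  constant term detects whether small elements of the annihilator vanish.
\<close>

definition h :: "'a poly" where
  "h = (SOME g. g \<in> ann_ideal \<and> lead_coeff g = 1 \<and> (\<forall>y\<in>ann_ideal. \<exists>u. y = u \<star> g))"

lemma h: "h \<in> ann_ideal" "lead_coeff h = 1" "y \<in> ann_ideal \<Longrightarrow> \<exists>u. y = u \<star> h"
proof -
  obtain x where "x \<in> ann_ideal" "x \<noteq> 0" using ann_ideal_nonzero by blast
  then have "\<exists>g\<in>ann_ideal. lead_coeff g = 1 \<and> (\<forall>y\<in>ann_ideal. \<exists>u. y = u \<star> g)"
    by (intro left_ideal_principal ann_ideal_closed)
  then have "\<exists>g. g \<in> ann_ideal \<and> lead_coeff g = 1 \<and> (\<forall>y\<in>ann_ideal. \<exists>u. y = u \<star> g)" by blast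
  from someI_ex[OF this]
  show "h \<in> ann_ideal" "lead_coeff h = 1" "y \<in> ann_ideal \<Longrightarrow> \<exists>u. y = u \<star> h"
    by (simp_all add: h_def)
qed

lemma h_nonzero: "h \<noteq> 0" using h(2) by auto

lemma degree_h_le:
  assumes "r \<in> ann_ideal" "r \<noteq> 0" shows "degree h \<le> degree r"
proof -
  obtain u where u: "r = u \<star> h" using h(3) assms by blast
  then have "u \<noteq> 0" using assms by auto
  then show ?thesis using degree_mul(1)[OF _ h_nonzero] u by simp
qed

lemma ann_ideal_eq_0:
  assumes "r \<in> ann_ideal" "\<forall>i\<ge>degree h. coeff r i = 0" shows "r = 0"
  using degree_h_le[OF assms(1)] coeff_bound_imp_degree_less[OF assms(2)] by force

text \<open>
  One degree more than in \<open>ann_ideal_eq_0\<close> is allowed: the only candidates are then constant multiples of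
  \<open>h\<close>, which are told from zero by the constant term.
\<close>

lemma ann_ideal_eq_0_of_coeff_0:
  assumes r: "r \<in> ann_ideal" "\<forall>i>degree h. coeff r i = 0" "coeff r 0 = 0"
    and h0: "coeff h 0 \<noteq> 0"
  shows "r = 0"
proof (rule ccontr)
  assume nz: "r \<noteq> 0"
  obtain u where u: "r = u \<star> h" using h(3) r by blast
  have "u \<noteq> 0" using nz u by auto
  then have "degree u + degree h = degree r" using degree_mul(1)[OF _ h_nonzero] u by simp
  moreover have "degree r \<le> degree h" using r(2) nz by (metis leading_coeff_0_iff not_le)
  ultimately have "degree u = 0" by simp
  moreover have "coeff u 0 = 0" using r(3) h0 coeff_mul_0 u by simp
  ultimately show False using \<open>u \<noteq> 0\<close> by (metis leading_coeff_0_iff)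
qed

lemma act_reduce: "\<exists>s. act r = act s \<and> (\<forall>i\<ge>degree h. coeff s i = 0)"
proof -
  obtain u v where uv: "r = u \<star> h + v" "deg_less v h"
    using skew_division_exists[OF aut h_nonzero] by blast
  have "r - v \<in> ann_ideal" using uv(1) ann_ideal_closed(2)[OF h(1)] by simp
  then show ?thesis using uv(2) by (auto simp: act_eq_iff deg_less_iff_coeff[OF h_nonzero])
qed

lemma act_inj: "inj_on act {s. \<forall>i\<ge>degree h. coeff s i = 0}"
  by (rule inj_onI) (use act_eq_iff ann_ideal_eq_0 in fastforce)

lemma card_range_act: "card (range act) = CARD('a) ^ degree h"
proof -
  let ?P = "{s :: 'a poly. \<forall>i\<ge>degree h. coeff s i = 0}"
  have "range act = act ` ?P" using act_reduce by (fastforce simp: image_iff)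
  then have "card (range act) = card ?P" by (simp add: card_image[OF act_inj])
  also have "?P = {p. (\<forall>i. coeff p i \<in> UNIV) \<and> (\<forall>i\<ge>degree h. coeff p i = 0)}" by auto
  finally show ?thesis
    using card_polys_with_coeffs_in[of "\<lambda>_. UNIV :: 'a set" "degree h"] by simp
qed

text \<open>
  If \<open>t v \<in> R f\<close>, then by degrees \<open>t v\<close> is a constant multiple of \<open>f\<close>, and its vanishing constant term
  makes that constant zero. So \<open>t\<close> is injective on the finite set of residues.
\<close>

lemma t_surj:
  assumes "w \<in> V" obtains v where "v \<in> V" "w = red (t \<star> v)"
proof -
  have "v = 0" if v: "v \<in> V" "red (t \<star> v) = 0" for v
  proof (rule ccontr)
    assume "v \<noteq> 0"
    obtain u where u: "t \<star> v = u \<star> f" using v red_eq_0_iff by blast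
    have t: "t \<noteq> 0" "degree t = 1" by (simp_all add: degree_monom_eq)
    have "u \<noteq> 0" using u degree_mul(2)[OF t(1) \<open>v \<noteq> 0\<close>] by auto
    have "degree u + degree f = Suc (degree v)"
      using u degree_mul(1)[OF t(1) \<open>v \<noteq> 0\<close>] degree_mul(1)[OF \<open>u \<noteq> 0\<close> f_nonzero] t(2) by simp
    then have "degree u = 0" using V_degree[OF v(1)] by simp
    moreover have "coeff u 0 * coeff f 0 = 0" using u coeff_mul_0 by (metis coeff_t_mul nat.case(1))
    ultimately show False using \<open>u \<noteq> 0\<close> coeff_0 by (metis leading_coeff_0_iff mult_eq_0_iff)
  qed
  then have "inj_on (\<lambda>v. red (t \<star> v)) V"
    by (intro inj_onI) (metis V_closed(4) eq_iff_diff_eq_0 minus_distrib(2) red_diff)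
  then have "(\<lambda>v. red (t \<star> v)) ` V = V"
    using finite_V by (intro endo_inj_surj) auto
  then show thesis using that assms by blast
qed

text \<open>
  Otherwise \<open>h = k t\<close>, and as \<open>t\<close> acts surjectively, \<open>k\<close> annihilates everything although its degree is
  smaller.
\<close>

lemma coeff_h_0: "coeff h 0 \<noteq> 0"
proof
  assume h0: "coeff h 0 = 0"
  obtain k where hk: "h = k \<star> t" and ck: "\<And>i. coeff k i = coeff h (Suc i)"
    using right_factor_t[OF h0] by blast
  have "red (k \<star> w) = 0" if w: "w \<in> V" for w
  proof -
    obtain v where v: "v \<in> V" "w = red (t \<star> v)" using t_surj[OF w] .
    have "red (k \<star> w) = red (h \<star> v)" by (simp add: v hk red_mul_red assoc)
    then show ?thesis using h(1) v by (simp add: ann_ideal_def)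
  qed
  then have "k \<in> ann_ideal" by (simp add: ann_ideal_def)
  moreover have "\<forall>i\<ge>degree h. coeff k i = 0" by (simp add: ck coeff_eq_0)
  ultimately have "k = 0" by (rule ann_ideal_eq_0)
  with hk h_nonzero show False by simp
qed

text \<open>
  The difference \<open>h c - \<sigma>\<^sup>N(c) h\<close> with \<open>N = deg h\<close> annihilates the residues and has degree below \<open>N\<close>, so it
  is zero; its constant term is \<open>h\<^sub>0 (c - \<sigma>\<^sup>N(c))\<close>.
\<close>

lemma pow_degree_h: "(\<sigma> ^^ degree h) c = c"
proof -
  let ?r = "h \<star> [:c:] - [:(\<sigma> ^^ degree h) c:] \<star> h"
  have coeff_r: "coeff ?r i = coeff h i * (\<sigma> ^^ i) c - (\<sigma> ^^ degree h) c * coeff h i" for i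
    by (simp add: coeff_mul_const coeff_const_mul)
  have "?r = 0"
  proof (rule ann_ideal_eq_0)
    show "?r \<in> ann_ideal" by (intro ann_ideal_closed h)
    show "\<forall>i\<ge>degree h. coeff ?r i = 0"
      unfolding coeff_r using h(2) coeff_eq_0[of h] by (auto simp: le_less)
  qed
  then have "coeff h 0 * c = (\<sigma> ^^ degree h) c * coeff h 0" using coeff_r[of 0] by simp
  then show ?thesis using coeff_h_0 by (simp add: mult.commute)
qed

lemma degree_h_pos: "degree h > 0"
proof (rule ccontr)
  assume "\<not> degree h > 0"
  then have "h = 1" using h(2) by (auto elim!: degree_eq_zeroE simp: one_pCons)
  then have "red 1 = 0" using h(1) V_closed(2) by (force simp: ann_ideal_def)
  then show False using red_id[OF V_closed(2)] by simp
qed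

lemma card_relations:
  "\<exists>k. CARD('a) ^ degree h = card V ^ k \<and> card V = card eigenring ^ k"
  using M.card_simple_module by (simp add: card_range_act card_commutant)

end

section \<open>The order of the automorphism\<close>

context skew_poly
begin

definition fixed_field :: "'a set" where
  "fixed_field = {x. \<sigma> x = x}"

lemma fixed_field_pow: "x \<in> fixed_field \<Longrightarrow> (\<sigma> ^^ i) x = x"
  by (induction i) (auto simp: fixed_field_def)

lemma aut_0_1: "\<sigma> 0 = 0" "\<sigma> 1 = 1"
  using aut_pow(1)[of 1] aut_pow(2)[of 1] by simp_all

lemma fixed_field_card: "card fixed_field \<ge> 2"
proof -
  have "{0, 1} \<subseteq> fixed_field" by (auto simp: fixed_field_def aut_0_1)
  then have "card {0, 1 :: 'a} \<le> card fixed_field" by (intro card_mono) auto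
  then show ?thesis by simp
qed

text \<open>
  Modulo \<open>t - 1\<close> the residues are the constants, on which \<open>t\<close> acts as \<open>\<sigma>\<close>, and the eigenring is the fixed
  field. The counting relations then read \<open>|K|\<^sup>N = |K|\<^sup>k\<close> and \<open>|K| = |F|\<^sup>k\<close> with \<open>N = deg h\<close>, so \<open>N = k = n\<close>.
  On the other hand \<open>N\<close> is the least positive exponent \<open>i\<close> with \<open>\<sigma>\<^sup>i = id\<close>, because for such \<open>i\<close> the
  polynomial \<open>t\<^sup>i - 1\<close> annihilates the constants.
\<close>

lemma automorphism_order:
  assumes n: "CARD('a) = card fixed_field ^ n"
  shows "(\<forall>c. (\<sigma> ^^ i) c = c) \<longleftrightarrow> n dvd i"
proof -
  define f where "f = [:-1, 1 :: 'a:]"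
  interpret S: skew_irreducible_modulus \<sigma> f
  proof
    show "degree f > 0" "coeff f 0 \<noteq> 0" by (simp_all add: f_def)
    have "\<not> (\<exists>a b. deg_less a f \<and> deg_less b f \<and> f = a \<star> b)"
    proof (rule notI, elim exE conjE)
      fix a b assume *: "deg_less a f" "deg_less b f" "f = a \<star> b"
      have "a \<noteq> 0" "b \<noteq> 0" using * by (auto simp: f_def)
      then have "degree f = degree a + degree b" using * degree_mul(1) by simp
      then show False using * \<open>a \<noteq> 0\<close> \<open>b \<noteq> 0\<close> by (simp add: deg_less_def f_def)
    qed
    then show "skew_irreducible \<sigma> f" by (simp add: skew_irreducible_def)
  qed
  have V: "S.V = range (\<lambda>c. [:c:])"
  proof (intro equalityI subsetI)
    fix v assume "v \<in> S.V"
    then have "degree v = 0" using S.V_degree[of v] by (simp add: f_def)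
    then show "v \<in> range (\<lambda>c. [:c:])" by (auto elim: degree_eq_zeroE)
  qed (auto intro: S.V_closed)
  have t_const: "S.red (t \<star> [:c:]) = [:\<sigma> c:]" for c
  proof (rule S.red_eqI)
    show "t \<star> [:c:] = [:\<sigma> c:] \<star> f + [:\<sigma> c:]"
      by (rule poly_eqI) (auto simp: coeff_t_mul coeff_const_mul f_def coeff_pCons aut_0_1 split: nat.split)
  qed (rule S.V_closed)
  have pow_const: "S.red (monom 1 i \<star> [:c:]) = [:(\<sigma> ^^ i) c:]" for i c
  proof (induction i arbitrary: c)
    case 0
    then show ?case using S.red_id[OF S.V_closed(3)] by simp
  next
    case (Suc i)
    have "monom 1 (Suc i) = monom 1 i \<star> t"
      using skew_mult_monom_monom[OF aut, of 1 i 1 1] by simp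
    then have "S.red (monom 1 (Suc i) \<star> [:c:]) = S.red (monom 1 i \<star> S.red (t \<star> [:c:]))"
      by (simp add: S.red_mul_red assoc)
    then show ?case by (simp add: t_const Suc funpow_swap1)
  qed
  have "S.eigenring = (\<lambda>c. [:c:]) ` fixed_field"
  proof -
    have "S.red (f \<star> [:c:]) = [:\<sigma> c - c:]" for c
    proof -
      have "f = t - 1" by (simp add: f_def monom_altdef one_pCons)
      then have "f \<star> [:c:] = t \<star> [:c:] - [:c:]" by (simp add: minus_distrib)
      then show ?thesis using t_const S.red_id[OF S.V_closed(3)] by (simp add: S.red_diff)
    qed
    then show ?thesis by (auto simp: S.eigenring_def V fixed_field_def)
  qed
  then have cE: "card S.eigenring = card fixed_field"
    by (simp add: card_image inj_on_def)
  have cV: "card S.V = CARD('a)" using S.card_V by (simp add: f_def)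
  have big: "CARD('a) \<ge> 2"
    using fixed_field_card card_mono[of UNIV fixed_field] by simp
  obtain k where "CARD('a) ^ degree S.h = CARD('a) ^ k" "CARD('a) = card fixed_field ^ k"
    using S.card_relations unfolding cV cE by blast
  then have deg: "degree S.h = n"
    using big fixed_field_card n by (simp add: power_inject_exp)
  have n_pos: "n > 0" using S.degree_h_pos deg by simp
  have least: "n \<le> i" if "i > 0" "\<forall>c. (\<sigma> ^^ i) c = c" for i
  proof -
    have "monom 1 i - 1 \<in> S.ann_ideal"
      unfolding S.ann_ideal_def V
      using pow_const[of i] that S.red_id[OF S.V_closed(3)] by (auto simp: minus_distrib S.red_diff)
    moreover have "degree (monom 1 i - 1 :: 'a poly) = i"
      using that by (intro antisym degree_diff_le le_degree) (auto simp: degree_monom_le coeff_1)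
    ultimately show ?thesis using S.degree_h_le[of "monom 1 i - 1"] that deg by fastforce
  qed
  have pow_n: "(\<sigma> ^^ n) c = c" for c using S.pow_degree_h deg by simp
  have mult_n: "(\<sigma> ^^ (n * j)) c = c" for j c
    by (induction j) (simp_all add: funpow_add pow_n)
  have mod: "(\<sigma> ^^ i) c = (\<sigma> ^^ (i mod n)) c" for c
  proof -
    have "(\<sigma> ^^ i) c = (\<sigma> ^^ (i mod n + n * (i div n))) c" by simp
    then show ?thesis by (simp only: funpow_add o_apply mult_n)
  qed
  show ?thesis
  proof
    assume "\<forall>c. (\<sigma> ^^ i) c = c"
    then have "\<forall>c. (\<sigma> ^^ (i mod n)) c = c" using mod by simp
    then have "\<not> i mod n > 0" using least[of "i mod n"] n_pos by (meson mod_less_divisor not_le)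
    then show "n dvd i" by (simp add: dvd_eq_mod_eq_0)
  qed (auto simp: mult_n elim!: dvdE)
qed

end

section \<open>The size of the eigenring\<close>

context skew_irreducible_modulus
begin

text \<open>
  By Schur's lemma right multiplication by a nonzero \<open>z\<close> is injective on the finite eigenring. So every
  nonzero element has a left inverse, which makes it a unit, and Wedderburn's theorem applies.
\<close>

lemma eigenring_commutative:
  assumes "x \<in> eigenring" "y \<in> eigenring"
  shows "red (x \<star> y) = red (y \<star> x)"
proof -
  define E :: "'a poly ring" where "E = \<lparr>carrier = eigenring, monoid.mult = (\<lambda>a b. red (a \<star> b)),
    one = 1, ring.zero = 0, add = (+)\<rparr>"
  have red_E: "red x = x" if "x \<in> eigenring" for x using that by (simp add: eigenring_def red_id)
  interpret E: ring E
  proof (rule ringI)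
    show "abelian_group E"
    proof (rule abelian_groupI)
      fix x assume "x \<in> carrier E"
      then show "\<exists>y \<in> carrier E. y \<oplus>\<^bsub>E\<^esub> x = \<zero>\<^bsub>E\<^esub>"
        using eigenring_closed(4)[of 0 x] eigenring_closed(1)
        by (intro bexI[of _ "- x"]) (simp_all add: E_def)
    qed (simp_all add: E_def eigenring_closed algebra_simps)
    show "Group.monoid E"
    proof (rule monoidI)
      fix x y z assume "x \<in> carrier E" "y \<in> carrier E" "z \<in> carrier E"
      then have "red (f \<star> z) = 0" by (simp add: E_def eigenring_def)
      then show "x \<otimes>\<^bsub>E\<^esub> y \<otimes>\<^bsub>E\<^esub> z = x \<otimes>\<^bsub>E\<^esub> (y \<otimes>\<^bsub>E\<^esub> z)"
        by (simp add: E_def red_red_mul red_mul_red assoc)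
    qed (simp_all add: E_def eigenring_closed red_E)
  qed (simp_all add: E_def distrib red_add)
  have left_inverse: "\<exists>w\<in>eigenring. w \<noteq> 0 \<and> red (w \<star> z) = 1" if z: "z \<in> eigenring" "z \<noteq> 0" for z
  proof -
    have rz: "rmul z \<in> M.commutant" using eigenring_commutant z by (auto simp: bij_betw_def)
    have "rmul z 1 = z" using red_E z by (simp add: rmul_def V_closed)
    moreover have "(\<lambda>v\<in>V. 0 :: 'a poly) 1 = 0" using V_closed(2) by simp
    ultimately have nz: "rmul z \<noteq> (\<lambda>v\<in>V. 0)" using z(2) by metis
    have "inj_on (\<lambda>w. red (w \<star> z)) eigenring"
    proof (rule inj_onI)
      fix u v assume *: "u \<in> eigenring" "v \<in> eigenring" "red (u \<star> z) = red (v \<star> z)"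
      have uv: "u - v \<in> V" using * by (simp add: eigenring_def V_closed)
      have "rmul z (u - v) = 0" using uv * by (simp add: rmul_def minus_distrib red_diff)
      then have "u - v = 0" using M.schur[OF rz uv] nz by blast
      then show "u = v" by simp
    qed
    moreover have "finite eigenring" using finite_V by (simp add: eigenring_def)
    ultimately have "(\<lambda>w. red (w \<star> z)) ` eigenring = eigenring"
      using eigenring_closed(5)[OF _ z(1)] by (intro endo_inj_surj) blast+
    then have "1 \<in> (\<lambda>w. red (w \<star> z)) ` eigenring" using eigenring_closed(2) by simp
    then obtain w where "w \<in> eigenring" "red (w \<star> z) = 1" by (elim imageE) simp
    moreover from this have "w \<noteq> 0" by auto
    ultimately show ?thesis by blast
  qed
  have "Units E = carrier E - {\<zero>\<^bsub>E\<^esub>}"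
  proof (intro equalityI subsetI)
    fix z assume "z \<in> carrier E - {\<zero>\<^bsub>E\<^esub>}"
    then have z: "z \<in> eigenring" "z \<noteq> 0" by (simp_all add: E_def)
    obtain w where w: "w \<in> eigenring" "w \<noteq> 0" "red (w \<star> z) = 1" using left_inverse[OF z] by blast
    obtain w' where w': "w' \<in> eigenring" "red (w' \<star> w) = 1" using left_inverse[OF w(1,2)] by blast
    have "w \<otimes>\<^bsub>E\<^esub> z = \<one>\<^bsub>E\<^esub>" "w' \<otimes>\<^bsub>E\<^esub> w = \<one>\<^bsub>E\<^esub>" using w w' by (simp_all add: E_def)
    moreover have "w \<in> carrier E" "w' \<in> carrier E" "z \<in> carrier E" using w w' z by (simp_all add: E_def)
    ultimately show "z \<in> Units E"
      using E.inv_unique[of w' w z] by (auto simp: Units_def)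
  next
    fix z assume z: "z \<in> Units E"
    have "(1 :: 'a poly) \<noteq> 0" by simp
    then have "\<one>\<^bsub>E\<^esub> \<noteq> \<zero>\<^bsub>E\<^esub>" by (simp add: E_def)
    then show "z \<in> carrier E - {\<zero>\<^bsub>E\<^esub>}"
      using z by (auto simp: Units_def)
  qed
  moreover have "finite (carrier E)" using finite_V by (simp add: E_def eigenring_def)
  ultimately have "x \<otimes>\<^bsub>E\<^esub> y = y \<otimes>\<^bsub>E\<^esub> x"
    using assms by (intro E.wedderburn_little) (simp_all add: E_def)
  then show ?thesis by (simp add: E_def)
qed

text \<open>
  As a commutative commutant, the eigenring consists of maps in \<open>A\<close>, and it is the image of the set \<open>C\<close>
  of polynomials in \<open>t\<^sup>n\<close> over the fixed field of degree below \<open>N = deg h\<close>. For if \<open>r\<close> of degree below \<open>N\<close>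
  acts as an element of the commutant, then \<open>r c - c r\<close> and \<open>r t - t r\<close> annihilate the residues and are so
  small that they vanish. The rest is comparing exponents of \<open>q\<close>.
\<close>

lemma card_eigenring:
  assumes n: "CARD('a) = card fixed_field ^ n"
  shows "card eigenring = card fixed_field ^ degree f"
proof -
  let ?q = "card fixed_field" and ?N = "degree h"
  note order = automorphism_order[OF n]
  define C where "C = {r. (\<forall>i. coeff r i \<in> (if n dvd i then fixed_field else {0})) \<and>
    (\<forall>i\<ge>?N. coeff r i = 0)}"
  have central: "r \<star> s = s \<star> r" if r: "r \<in> C" for r s
  proof (rule poly_eqI)
    fix m
    have fix_r: "coeff r i \<in> fixed_field" for i
      using r by (auto simp: C_def fixed_field_def aut_0_1 split: if_splits)
    have "coeff (r \<star> s) m = (\<Sum>i\<le>m. coeff r i * coeff s (m - i))"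
      unfolding coeff_mul
    proof (rule sum.cong[OF refl])
      fix i
      have "coeff r i \<in> (if n dvd i then fixed_field else {0})" using r unfolding C_def by blast
      then show "coeff r i * (\<sigma> ^^ i) (coeff s (m - i)) = coeff r i * coeff s (m - i)"
        using order[of i] by (cases "n dvd i") simp_all
    qed
    also have "\<dots> = coeff (r * s) m" by (simp add: coeff_mult)
    also have "\<dots> = coeff (s * r) m" by (simp add: mult.commute)
    also have "\<dots> = coeff (s \<star> r) m"
      by (simp add: coeff_mul coeff_mult fixed_field_pow[OF fix_r])
    finally show "coeff (r \<star> s) m = coeff (s \<star> r) m" .
  qed
  have "M.commutant = act ` C"
  proof (intro equalityI subsetI)
    fix \<delta> assume "\<delta> \<in> act ` C"
    then obtain r where r: "r \<in> C" "\<delta> = act r" by blast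
    have "red (r \<star> red (s \<star> v)) = red (s \<star> red (r \<star> v))" for s v
      using central[OF r(1), of s] by (simp add: red_mul_red flip: assoc)
    then show "\<delta> \<in> M.commutant"
      using M.A_additive[of \<delta>] r(2)
      unfolding M.commutant_def by (auto simp: act_def)
  next
    fix \<delta> assume \<delta>: "\<delta> \<in> M.commutant"
    then obtain z where z: "z \<in> eigenring" "\<delta> = rmul z"
      using eigenring_commutant by (auto simp: bij_betw_def)
    have "\<delta> \<in> range act"
    proof (rule M.double_commutant)
      show "additive_on V \<delta>" by (rule M.commutantD[OF \<delta>])
      fix \<epsilon> v assume "\<epsilon> \<in> M.commutant" and v: "v \<in> V"
      then obtain w where w: "w \<in> eigenring" "\<epsilon> = rmul w"
        using eigenring_commutant by (auto simp: bij_betw_def)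
      have "red (red (v \<star> w) \<star> z) = red (v \<star> red (w \<star> z))"
        using z(1) by (simp add: red_red_mul red_mul_red assoc eigenring_def)
      also have "\<dots> = red (v \<star> red (z \<star> w))" using eigenring_commutative z w by simp
      also have "\<dots> = red (red (v \<star> z) \<star> w)"
        using w(1) by (simp add: red_red_mul red_mul_red assoc eigenring_def)
      finally show "\<delta> (\<epsilon> v) = \<epsilon> (\<delta> v)" using v by (simp add: z w rmul_def)
    qed
    then obtain r where r: "\<delta> = act r" "\<forall>i\<ge>?N. coeff r i = 0" using act_reduce by fastforce
    have comm: "r \<star> s - s \<star> r \<in> ann_ideal" for s
    proof -
      have "act r (act s v) = act s (act r v)" if "v \<in> V" for v
        using M.commutantD(2)[OF \<delta>, of "act s" v] that by (simp add: r)
      then show ?thesis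
        by (auto simp: ann_ideal_def act_def minus_distrib red_diff red_mul_red assoc)
    qed
    have "coeff r i \<in> (if n dvd i then fixed_field else {0})" for i
    proof -
      have "coeff r i = 0" if "\<not> n dvd i"
      proof (rule ccontr)
        assume nz: "coeff r i \<noteq> 0"
        have "(\<sigma> ^^ i) c = c" for c
        proof -
          have "r \<star> [:c:] - [:c:] \<star> r = 0"
            using r(2) by (intro ann_ideal_eq_0 comm) (simp add: coeff_mul_const coeff_const_mul)
          then have "coeff (r \<star> [:c:]) i = coeff ([:c:] \<star> r) i" by simp
          then show ?thesis using nz by (simp add: coeff_mul_const coeff_const_mul)
        qed
        with order that show False by blast
      qed
      moreover have "\<sigma> (coeff r i) = coeff r i"
      proof -
        have "r \<star> t - t \<star> r = 0"
          using r(2) coeff_h_0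
          by (intro ann_ideal_eq_0_of_coeff_0 comm)
            (auto simp: coeff_mul_t coeff_t_mul aut_0_1 split: nat.split)
        then have "coeff (r \<star> t) (Suc i) = coeff (t \<star> r) (Suc i)" by simp
        then show ?thesis by (simp add: coeff_mul_t coeff_t_mul)
      qed
      ultimately show ?thesis by (simp add: fixed_field_def)
    qed
    then have "r \<in> C" using r(2) by (simp add: C_def)
    then show "\<delta> \<in> act ` C" using r by blast
  qed
  moreover have "inj_on act C" by (rule inj_on_subset[OF act_inj]) (auto simp: C_def)
  ultimately have "card eigenring = card C" by (simp add: card_image flip: card_commutant)
  also have "card C = (\<Prod>i<?N. card (if n dvd i then fixed_field else {0}))"
    unfolding C_def
    by (rule card_polys_with_coeffs_in) (auto simp: fixed_field_def aut_0_1)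
  finally have card_E: "card eigenring = (\<Prod>i<?N. card (if n dvd i then fixed_field else {0}))" .
  have "n dvd ?N" using order pow_degree_h by blast
  then obtain e where e: "?N = n * e" by (auto elim: dvdE)
  have n_pos: "n > 0" and e_pos: "e > 0" using degree_h_pos e by (auto intro: Nat.gr0I)
  have "card eigenring = ?q ^ e"
  proof -
    have "(\<Prod>i<?N. card (if n dvd i then fixed_field else {0})) = (\<Prod>i\<in>{i. i < ?N \<and> n dvd i}. ?q)"
      by (rule prod.mono_neutral_cong_right) auto
    also have "{i. i < ?N \<and> n dvd i} = (*) n ` {..<e}"
      using n_pos by (auto simp: e)
    finally show ?thesis using n_pos by (simp add: card_E card_image inj_on_def)
  qed
  moreover obtain k where k: "CARD('a) ^ ?N = card V ^ k" "card V = card eigenring ^ k"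
    using card_relations by blast
  moreover have q1: "?q > 1" using fixed_field_card by simp
  ultimately have "?q ^ (n * degree f) = ?q ^ (e * k)" "?q ^ (n * (n * e)) = ?q ^ (n * (degree f * k))"
    using e by (auto simp add: n card_V simp flip: power_mult)
  then have 1: "n * degree f = e * k" and 2: "n * (n * e) = n * (degree f * k)"
    using power_inject_exp[OF q1] by blast+
  \<comment> \<open>With \<open>N = n e\<close> this compares \<open>n N = n d k\<close> with \<open>n d = e k\<close>, where \<open>d = deg f\<close>.\<close>
  have "n * n * e = (n * degree f) * k" using 2 by (simp only: mult.assoc)
  also have "\<dots> = k * k * e" unfolding 1 by simp
  finally have "n * n * e = k * k * e" .
  then have "n * n = k * k" using e_pos by simp
  then have "n = k" by (metis power2_eq_square power2_eq_imp_eq le0)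
  then have "degree f = e" using 1 n_pos by simp
  then show ?thesis using \<open>card eigenring = ?q ^ e\<close> by simp
qed

end

section \<open>Nuclei and centre\<close>

context skew_modulus
begin

abbreviation S :: "'a poly ring" where
  "S \<equiv> skew_semifield \<sigma> f"

lemma S_simps: "carrier S = V" "x \<otimes>\<^bsub>S\<^esub> y = red (x \<star> y)"
  by (simp_all add: skew_semifield_def V_def)

lemma associates_iff:
  "x \<otimes>\<^bsub>S\<^esub> (y \<otimes>\<^bsub>S\<^esub> z) = (x \<otimes>\<^bsub>S\<^esub> y) \<otimes>\<^bsub>S\<^esub> z \<longleftrightarrow>
    red (x \<star> y \<star> z) = red (red (x \<star> y) \<star> z)"
  by (simp add: S_simps red_mul_red assoc)

definition constants :: "'a poly set" where
  "constants = range (\<lambda>c. [:c:])"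

lemma card_constants: "card constants = CARD('a)"
  by (simp add: constants_def card_image inj_on_def)

lemma const_mul_in_V:
  assumes "v \<in> V" shows "[:c:] \<star> v \<in> V" "v \<star> [:c:] \<in> V"
  using assms by (simp_all add: V_iff coeff_const_mul coeff_mul_const)

lemma constants_in_nuclei:
  "constants \<subseteq> left_nucleus S" "constants \<subseteq> middle_nucleus S"
  unfolding left_nucleus_def middle_nucleus_def associates_iff
  by (auto simp: constants_def S_simps(1) V_closed red_id const_mul_in_V)

text \<open>
  If \<open>x y\<close> has exactly the degree of \<open>f\<close>, its quotient by \<open>f\<close> is a nonzero constant \<open>c\<close>, and associativity
  says \<open>c f z \<in> R f\<close>.
\<close>

lemma red_f_mul_eq_0_if_associates_at_degree_f:
  assumes x: "x \<noteq> 0" and y: "y \<noteq> 0" and deg: "degree x + degree y = degree f"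
    and ass: "x \<otimes>\<^bsub>S\<^esub> (y \<otimes>\<^bsub>S\<^esub> z) = (x \<otimes>\<^bsub>S\<^esub> y) \<otimes>\<^bsub>S\<^esub> z"
  shows "red (f \<star> z) = 0"
proof -
  define a where "a = x \<star> y"
  have a: "degree a = degree f" "a \<noteq> 0" using degree_mul[OF x y] deg by (simp_all add: a_def)
  define c where "c = lead_coeff a / lead_coeff f"
  have c: "c \<noteq> 0" unfolding c_def using a(2) f_nonzero by (metis divide_eq_0_iff leading_coeff_0_iff)
  have "a - [:c:] \<star> f \<in> V"
    using a f_nonzero coeff_eq_0[of a] coeff_eq_0[of f]
    by (auto simp: V_iff coeff_const_mul c_def le_less)
  then have red_a: "red a = a - [:c:] \<star> f" by (intro red_eqI[of _ "[:c:]"]) simp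
  have "red (a \<star> z) = red ((a - [:c:] \<star> f) \<star> z)"
    using ass unfolding associates_iff a_def[symmetric] red_a .
  then have "red ([:c:] \<star> (f \<star> z)) = 0" by (simp add: minus_distrib red_diff assoc)
  then have "red ([:inverse c:] \<star> red ([:c:] \<star> (f \<star> z))) = 0" by simp
  then have "red (([:inverse c:] \<star> [:c:]) \<star> (f \<star> z)) = 0" by (simp add: red_mul_red assoc)
  then show ?thesis using c by (simp add: const_mul_const flip: one_pCons)
qed

text \<open>
  Degree at least 2 provides two residues, \<open>t\<^bsup>d-1\<^esup>\<close> and \<open>t\<close>, whose product has degree \<open>d = deg f\<close>.
\<close>

lemma right_nucleus_eq:
  assumes "degree f \<ge> 2"
  shows "right_nucleus S = eigenring"
proof (intro equalityI subsetI)
  fix z assume z: "z \<in> right_nucleus S"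
  let ?x = "monom 1 (degree f - 1) :: 'a poly"
  have "?x \<in> V" "t \<in> V" using assms by (intro V_I; simp add: degree_monom_eq)+
  then have "?x \<otimes>\<^bsub>S\<^esub> (t \<otimes>\<^bsub>S\<^esub> z) = (?x \<otimes>\<^bsub>S\<^esub> t) \<otimes>\<^bsub>S\<^esub> z"
    using z by (simp add: right_nucleus_def S_simps(1))
  moreover have "degree ?x + degree t = degree f" using assms by (simp add: degree_monom_eq)
  ultimately have "red (f \<star> z) = 0" by (intro red_f_mul_eq_0_if_associates_at_degree_f[of ?x t]) simp_all
  then show "z \<in> eigenring" using z by (simp add: eigenring_def right_nucleus_def S_simps(1))
next
  fix z assume "z \<in> eigenring"
  then show "z \<in> right_nucleus S"
    unfolding right_nucleus_def associates_iff by (auto simp: eigenring_def red_red_mul S_simps(1))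
qed

text \<open>
  A nonconstant residue has a partner, on either side, such that the product has the degree of \<open>f\<close>. If all
  triples with this element associated, every residue would lie in the eigenring.
\<close>

lemma left_middle_nucleus_eq:
  assumes proper: "eigenring \<noteq> V"
  shows "left_nucleus S = constants" "middle_nucleus S = constants"
proof -
  have const: "x \<in> constants" if x: "x \<in> V"
    and y: "\<And>y z. y \<in> V \<Longrightarrow> z \<in> V \<Longrightarrow> y \<noteq> 0 \<Longrightarrow> degree x + degree y = degree f \<Longrightarrow> x \<noteq> 0 \<Longrightarrow>
      red (f \<star> z) = 0" for x
  proof (rule ccontr)
    assume "x \<notin> constants"
    then have "degree x > 0" by (metis constants_def degree_eq_zeroE gr0I rangeI)
    let ?y = "monom 1 (degree f - degree x) :: 'a poly"
    have deg: "degree x < degree f" by (rule V_degree[OF x])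
    have "?y \<in> V" using \<open>degree x > 0\<close> deg by (intro V_I) (simp add: degree_monom_eq)
    moreover have "degree x + degree ?y = degree f" using deg by (simp add: degree_monom_eq)
    moreover have "x \<noteq> 0" using \<open>degree x > 0\<close> by auto
    ultimately have "red (f \<star> z) = 0" if "z \<in> V" for z using y[of ?y z] that by simp
    then have "eigenring = V" by (auto simp: eigenring_def)
    with proper show False by simp
  qed
  have "left_nucleus S \<subseteq> constants"
  proof
    fix x assume x: "x \<in> left_nucleus S"
    show "x \<in> constants"
    proof (rule const)
      show "x \<in> V" using x by (simp add: left_nucleus_def S_simps(1))
      fix y z assume "y \<in> V" "z \<in> V" "y \<noteq> 0" "degree x + degree y = degree f" "x \<noteq> 0"
      then show "red (f \<star> z) = 0"
        using x by (intro red_f_mul_eq_0_if_associates_at_degree_f[of x y]) (auto simp: left_nucleus_def S_simps(1))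
    qed
  qed
  then show "left_nucleus S = constants" using constants_in_nuclei by blast
  have "middle_nucleus S \<subseteq> constants"
  proof
    fix x assume x: "x \<in> middle_nucleus S"
    show "x \<in> constants"
    proof (rule const)
      show "x \<in> V" using x by (simp add: middle_nucleus_def S_simps(1))
      fix y z assume "y \<in> V" "z \<in> V" "y \<noteq> 0" "degree x + degree y = degree f" "x \<noteq> 0"
      then show "red (f \<star> z) = 0"
        using x by (intro red_f_mul_eq_0_if_associates_at_degree_f[of y x]) (auto simp: middle_nucleus_def S_simps(1))
    qed
  qed
  then show "middle_nucleus S = constants" using constants_in_nuclei by blast
qed

lemma fixed_const_central: "c \<in> fixed_field \<Longrightarrow> a \<star> [:c:] = [:c:] \<star> a"
  by (rule poly_eqI) (simp add: coeff_mul_const coeff_const_mul fixed_field_pow)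

text \<open>
  A constant \<open>c\<close> commutes with \<open>t\<close> exactly if \<open>\<sigma>(c) = c\<close>; degree at least 2 ensures that \<open>t\<close> is a residue.
\<close>

lemma centre_eq:
  assumes deg: "degree f \<ge> 2" and proper: "eigenring \<noteq> V"
  shows "semifield_centre S = (\<lambda>c. [:c:]) ` fixed_field"
proof (intro equalityI subsetI)
  fix x assume x: "x \<in> semifield_centre S"
  then have "x \<in> constants" using left_middle_nucleus_eq[OF proper] by (simp add: semifield_centre_def)
  then obtain c where c: "x = [:c:]" by (auto simp: constants_def)
  have tV: "t \<in> V" using deg by (intro V_I) (simp add: degree_monom_eq)
  then have "red (x \<star> t) = red (t \<star> x)" using x by (simp add: semifield_centre_def S_simps)
  then have "[:c:] \<star> t = t \<star> [:c:]" using tV by (simp add: c red_id const_mul_in_V)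
  then have "coeff ([:c:] \<star> t) 1 = coeff (t \<star> [:c:]) 1" by simp
  then have "\<sigma> c = c" by (simp add: coeff_const_mul coeff_mul_const)
  then show "x \<in> (\<lambda>c. [:c:]) ` fixed_field" by (simp add: c fixed_field_def)
next
  fix x assume "x \<in> (\<lambda>c. [:c:]) ` fixed_field"
  then obtain c where c: "x = [:c:]" "c \<in> fixed_field" by blast
  have "x \<in> left_nucleus S" "x \<in> middle_nucleus S"
    using constants_in_nuclei c by (auto simp: constants_def)
  moreover have "x \<in> eigenring"
    by (simp add: eigenring_def c fixed_const_central V_closed)
  moreover have "x \<star> y = y \<star> x" for y using fixed_const_central c by simp
  ultimately show "x \<in> semifield_centre S"
    by (simp add: semifield_centre_def S_simps right_nucleus_eq[OF deg])
qed

lemma nuclei_degree_1: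
  assumes "degree f = 1"
  shows "left_nucleus S = constants" "middle_nucleus S = constants" "right_nucleus S = constants"
    "semifield_centre S = constants"
proof -
  have V: "V = constants"
    using assms V_degree by (force simp: constants_def V_closed elim: degree_eq_zeroE)
  have mult: "red ([:a:] \<star> [:b:]) = [:a * b:]" for a b by (simp add: const_mul_const red_id V_closed)
  show "left_nucleus S = constants" "middle_nucleus S = constants" "right_nucleus S = constants"
    by (auto simp: left_nucleus_def middle_nucleus_def right_nucleus_def S_simps V constants_def
        mult mult.assoc)
  then show "semifield_centre S = constants"
    by (auto simp: semifield_centre_def S_simps V) (auto simp: constants_def mult mult.commute)
qed

end

theorem theorem9:
  fixes \<sigma> :: "'a::{field, finite} \<Rightarrow> 'a" and f :: "'a poly" and q n d :: nat
  assumes "CARD('a) = q ^ n"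
    and "field_automorphism \<sigma>"
    and "card {x. \<sigma> x = x} = q"
    and "skew_irreducible \<sigma> f"
    and "degree f = d"
    and "(n \<ge> 2 \<and> d \<ge> 2) \<or> (n = 1 \<and> d = 1)"
  shows "(card (semifield_centre (skew_semifield \<sigma> f)),
          card (left_nucleus (skew_semifield \<sigma> f)),
          card (middle_nucleus (skew_semifield \<sigma> f)),
          card (right_nucleus (skew_semifield \<sigma> f))) = (q, q ^ n, q ^ n, q ^ d)"
proof -
  interpret skew_modulus \<sigma> f
    using assms(2,5,6) by unfold_locales auto
  have q: "card fixed_field = q" using assms(3) by (simp add: fixed_field_def)
  from assms(6) show ?thesis
  proof
    assume "n = 1 \<and> d = 1"
    then show ?thesis using nuclei_degree_1 assms(1,5) by (simp add: card_constants)
  next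
    assume nd: "n \<ge> 2 \<and> d \<ge> 2"
    then have deg: "degree f \<ge> 2" using assms(5) by simp
    \<comment> \<open>In degree at least 2 an irreducible \<open>f\<close> is not divisible by \<open>t\<close>.\<close>
    have "coeff f 0 \<noteq> 0"
    proof
      assume f0: "coeff f 0 = 0"
      obtain g where fg: "f = g \<star> t" and cg: "\<And>i. coeff g i = coeff f (Suc i)"
        using right_factor_t[OF f0] by blast
      have "deg_less g f"
        unfolding deg_less_iff_coeff[OF f_nonzero] by (simp add: cg coeff_eq_0)
      moreover have "deg_less t f" using deg f_nonzero by (simp add: deg_less_def degree_monom_eq)
      ultimately show False using assms(4) fg by (auto simp: skew_irreducible_def)
    qed
    then interpret skew_irreducible_modulus \<sigma> f
      using assms(4) by unfold_locales
    have E: "card eigenring = q ^ d" using card_eigenring assms(1,5) q by simp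
    have "q \<ge> 2" using fixed_field_card q by simp
    moreover have "card V = q ^ (n * d)" using card_V assms(1,5) by (simp add: power_mult)
    moreover have "d \<noteq> n * d" using nd by simp
    ultimately have proper: "eigenring \<noteq> V" using E by auto
    have "card (semifield_centre S) = q"
      unfolding centre_eq[OF deg proper] using q by (simp add: card_image inj_on_def)
    then show ?thesis
      using E assms(1) by (simp add: left_middle_nucleus_eq[OF proper] card_constants right_nucleus_eq[OF deg])
  qed
qed

end
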